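(* Let $\alpha\in(0,1)$ and $\beta\in(0,1-\alpha)$ be fixed, let $R>0$, let $a=(a_j)_{j\in J}$ be a monotone non-decreasing sequence of positive numbers, and let $$\mathcal{E}_{a,2}(R)=\Bigl\{\nu\in l_2(J):\ \sum_{j\in J}a_j^2\nu_j^2\le R^2\Bigr\}.$$ For $D\in J$ put $\rho_D^2=c(\alpha,\beta)\bigl(\sum_{j=1}^D\sigma_j^4\bigr)^{1/2}$ with $c(\alpha,\beta)=\bigl(2\ln(1+4(1-\alpha-\beta)^2)\bigr)^{1/2}$. Then $$\rho_2^2(\mathcal{E}_{a,2}(R),\alpha,\beta)\ge\sup_{D\in J}\bigl(\rho_D^2\wedge R^2a_D^{-2}\bigr).$$ Moreover, there is a positive constant $C=C(\alpha,\beta)$ depending only on $\alpha$ and $\beta$ such that, for all $D\in J$, $$\sup_{\theta\in\mathcal{E}_{a,2}(R),\ \|\theta\|_2^2\ge C\rho_D^2+R^2a_D^{-2}}\mathbb{P}_\theta(\Phi_\alpha=0)\le\beta,$$ where $\Phi_\alpha=\mathbf{1}_{\{\sum_{j=1}^DY_j^2>t_{D,1-\alpha}(\sigma)\}}$ and $t_{D,1-\alpha}(\sigma)$ is the $1-\alpha$ quantile of $\sum_{j=1}^D\sigma_j^2\epsilon_j^2$. Hence $$\rho_2^2(\mathcal{E}_{a,2}(R),\alpha,\beta)\le\inf_{D\in J}\bigl(C\rho_D^2+R^2a_D^{-2}\bigr).$$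
   Context: Model: $J=\{1,\dots,N\}$ for some integer $N\ge1$, or $J=\{1,2,3,\dots\}$. One observes $Y=(Y_j)_{j\in J}$ with $Y_j=\theta_j+\sigma_j\epsilon_j$, where $\theta=(\theta_j)_{j\in J}$ is unknown, $\sigma_j>0$ are known, and $(\epsilon_j)_{j\in J}$ are i.i.d. standard normal. $\mathbb{P}_\theta$ is the distribution of $Y$. $\|\theta\|_2^2=\sum_{j\in J}\theta_j^2$, and $x\wedge y=\min(x,y)$. A test is a measurable function $\Phi$ of $Y$ with values in $\{0,1\}$; the null hypothesis "$\theta=0$" is rejected iff $\Phi=1$. It has level $\alpha$ if $\mathbb{P}_0(\Phi=1)\le\alpha$. For $\mathcal{F}\subset l_2(J)$ and a level-$\alpha$ test $\Phi_\alpha$, $\rho_2(\Phi_\alpha,\mathcal{F},\beta)=\inf\{\rho>0:\ \inf_{\theta\in\mathcal{F},\|\theta\|_2\ge\rho}\mathbb{P}_\theta(\Phi_\alpha=1)>1-\beta\}$ (the condition on $\rho$ holds vacuously if no $\theta\in\mathcal{F}$ has $\|\theta\|_2\ge\rho$), and the $(\alpha,\beta)$ minimax rate of testing $\rho_2(\mathcal{F},\alpha,\beta)$ is the infimum of $\rho_2(\Phi_\alpha,\mathcal{F},\beta)$ over all level-$\alpha$ tests $\Phi_\alpha$. A supremum of probabilities over an empty set of $\theta$ is $0$. *)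

theory Defs
  imports "HOL-Probability.Probability"
begin

definition index_set :: "nat set \<Rightarrow> bool" where
  "index_set J \<longleftrightarrow> (\<exists>N\<ge>1. J = {1..N}) \<or> J = {1..}"

definition noise :: "nat set \<Rightarrow> (nat \<Rightarrow> real) measure" where
  "noise J = PiM J (\<lambda>_. std_normal_distribution)"

abbreviation sample_space :: "nat set \<Rightarrow> (nat \<Rightarrow> real) measure" where
  "sample_space J \<equiv> PiM J (\<lambda>_. borel)"

definition obs_law :: "nat set \<Rightarrow> (nat \<Rightarrow> real) \<Rightarrow> (nat \<Rightarrow> real) \<Rightarrow> (nat \<Rightarrow> real) measure" where
  "obs_law J \<sigma> \<theta> = distr (noise J) (sample_space J) (\<lambda>\<epsilon>. \<lambda>j\<in>J. \<theta> j + \<sigma> j * \<epsilon> j)"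

definition accept_prob :: "nat set \<Rightarrow> (nat \<Rightarrow> real) \<Rightarrow> (nat \<Rightarrow> real) \<Rightarrow> ((nat \<Rightarrow> real) \<Rightarrow> nat) \<Rightarrow> ennreal" where
  "accept_prob J \<sigma> \<theta> \<Phi> = emeasure (obs_law J \<sigma> \<theta>) {y \<in> space (sample_space J). \<Phi> y = 0}"

definition reject_prob :: "nat set \<Rightarrow> (nat \<Rightarrow> real) \<Rightarrow> (nat \<Rightarrow> real) \<Rightarrow> ((nat \<Rightarrow> real) \<Rightarrow> nat) \<Rightarrow> ennreal" where
  "reject_prob J \<sigma> \<theta> \<Phi> = emeasure (obs_law J \<sigma> \<theta>) {y \<in> space (sample_space J). \<Phi> y = 1}"

definition level_tests :: "nat set \<Rightarrow> (nat \<Rightarrow> real) \<Rightarrow> real \<Rightarrow> ((nat \<Rightarrow> real) \<Rightarrow> nat) set" where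
  "level_tests J \<sigma> \<alpha> =
     {\<Phi> \<in> sample_space J \<rightarrow>\<^sub>M count_space {0, 1}. reject_prob J \<sigma> (\<lambda>_. 0) \<Phi> \<le> ennreal \<alpha>}"

text \<open>Families indexed by \<open>J\<close> are represented, as in \<^const>\<open>PiM\<close>, by functions that are
  \<^const>\<open>undefined\<close> outside \<open>J\<close>.\<close>

definition l2 :: "nat set \<Rightarrow> (nat \<Rightarrow> real) set" where
  "l2 J = {\<theta> \<in> extensional J. (\<lambda>j. (\<theta> j)\<^sup>2) summable_on J}"

definition l2_norm :: "nat set \<Rightarrow> (nat \<Rightarrow> real) \<Rightarrow> real" where
  "l2_norm J \<theta> = sqrt (\<Sum>\<^sub>\<infinity>j\<in>J. (\<theta> j)\<^sup>2)"

text \<open>Summability is required explicitly, since \<^const>\<open>infsum\<close> is \<open>0\<close> for divergent sums.\<close>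

definition ellipsoid :: "nat set \<Rightarrow> (nat \<Rightarrow> real) \<Rightarrow> real \<Rightarrow> (nat \<Rightarrow> real) set" where
  "ellipsoid J a R =
     {\<nu> \<in> l2 J. (\<lambda>j. (a j)\<^sup>2 * (\<nu> j)\<^sup>2) summable_on J \<and> (\<Sum>\<^sub>\<infinity>j\<in>J. (a j)\<^sup>2 * (\<nu> j)\<^sup>2) \<le> R\<^sup>2}"

text \<open>Rates are \<^typ>\<open>ennreal\<close>-valued, so that an infimum over no radius at all is \<open>\<infinity>\<close>. The
  inner infimum of probabilities is \<open>\<infinity>\<close> as well if no alternative has norm at least
  \<open>\<rho>\<close>; the condition on \<open>\<rho>\<close> then holds vacuously.\<close>

definition test_rate :: "nat set \<Rightarrow> (nat \<Rightarrow> real) \<Rightarrow> ((nat \<Rightarrow> real) \<Rightarrow> nat) \<Rightarrow> (nat \<Rightarrow> real) set \<Rightarrow> real \<Rightarrow> ennreal" where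
  "test_rate J \<sigma> \<Phi> F \<beta> =
     (INF \<rho>\<in>{\<rho>. \<rho> > 0 \<and> (INF \<theta>\<in>{\<theta> \<in> F. l2_norm J \<theta> \<ge> \<rho>}. reject_prob J \<sigma> \<theta> \<Phi>) > ennreal (1 - \<beta>)}. ennreal \<rho>)"

definition minimax_rate :: "nat set \<Rightarrow> (nat \<Rightarrow> real) \<Rightarrow> (nat \<Rightarrow> real) set \<Rightarrow> real \<Rightarrow> real \<Rightarrow> ennreal" where
  "minimax_rate J \<sigma> F \<alpha> \<beta> = (INF \<Phi>\<in>level_tests J \<sigma> \<alpha>. test_rate J \<sigma> \<Phi> F \<beta>)"

definition c_const :: "real \<Rightarrow> real \<Rightarrow> real" where
  "c_const \<alpha> \<beta> = sqrt (2 * ln (1 + 4 * (1 - \<alpha> - \<beta>)\<^sup>2))"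

definition rho_sq :: "real \<Rightarrow> real \<Rightarrow> (nat \<Rightarrow> real) \<Rightarrow> nat \<Rightarrow> real" where
  "rho_sq \<alpha> \<beta> \<sigma> D = c_const \<alpha> \<beta> * sqrt (\<Sum>j=1..D. (\<sigma> j) ^ 4)"

definition quantile :: "real measure \<Rightarrow> real \<Rightarrow> real" where
  "quantile M p = Inf {t. cdf M t \<ge> p}"

definition chi_quantile :: "nat set \<Rightarrow> (nat \<Rightarrow> real) \<Rightarrow> nat \<Rightarrow> real \<Rightarrow> real" where
  "chi_quantile J \<sigma> D p =
     quantile (distr (noise J) borel (\<lambda>\<epsilon>. \<Sum>j=1..D. (\<sigma> j)\<^sup>2 * (\<epsilon> j)\<^sup>2)) p"

definition chi_test :: "nat set \<Rightarrow> (nat \<Rightarrow> real) \<Rightarrow> nat \<Rightarrow> real \<Rightarrow> (nat \<Rightarrow> real) \<Rightarrow> nat" where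
  "chi_test J \<sigma> D \<alpha> y = (if (\<Sum>j=1..D. (y j)\<^sup>2) > chi_quantile J \<sigma> D (1 - \<alpha>) then 1 else 0)"

end

theory Submission
  imports Defs
begin

text \<open>
  The rate is a trade-off between two features of the first \<open>D\<close> coordinates: how much signal energy the noise
  in them can hide, which is \<^const>\<open>rho_sq\<close>, and how much energy of an element of the ellipsoid can lie beyond them,
  or be put into them without leaving the ellipsoid; both of the latter are governed by \<open>R\<^sup>2 / (a D)\<^sup>2\<close>, because the
  weights increase.

  Lower bound. Consider signals whose energy in coordinate \<open>j \<le> D\<close> is proportional to \<open>\<sigma> j ^ 4\<close>, with total energy
  \<open>\<rho>\<^sup>2\<close> and with unknown signs. If \<open>\<rho> \<le> R / a D\<close> they all belong to the ellipsoid. Drawing the signs at random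
  produces a mixture whose likelihood ratio with respect to pure noise is explicit by the Cameron-Martin formula
  (\<open>cameron_martin_noise\<close>), and its second moment is at most \<open>1 + 4 * (1 - \<alpha> - \<beta>)\<^sup>2\<close> as soon as \<open>\<rho>\<^sup>2\<close> is at most
  \<^const>\<open>rho_sq\<close>. A test cannot gain more than \<open>1 - \<alpha> - \<beta>\<close> of power over its level \<open>\<alpha>\<close> against such a mixture
  (\<open>measure_density_le_of_second_moment\<close>), so some signal of norm \<open>\<rho>\<close> is detected with probability at most
  \<open>1 - \<beta>\<close> (\<open>minimax_lower_bound\<close>).

  Upper bound. The statistic \<open>\<Sum>j=1..D. (y j)\<^sup>2\<close> has expectation \<open>\<Sum>j=1..D. (\<theta> j)\<^sup>2 + (\<sigma> j)\<^sup>2\<close>, and its variance is at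
  most of order \<open>s\<^sup>2 + s * S\<close>, where \<open>s\<close> is the root of \<open>\<Sum>j=1..D. \<sigma> j ^ 4\<close> and \<open>S\<close> is the energy of \<open>\<theta>\<close> in these coordinates.
  Chebyshev's inequality bounds both the quantile under the null hypothesis and the probability of accepting
  under \<open>\<theta>\<close>, and the latter is small once \<open>S\<close> is a large multiple of \<open>s\<close> (\<open>chi_test_accept_le\<close>). An element of the
  ellipsoid with energy at least \<open>C * rho_sq \<alpha> \<beta> \<sigma> D + R\<^sup>2 / (a D)\<^sup>2\<close> has this property (\<open>ellipsoid_l2_norm_le\<close>).
\<close>

section \<open>Coordinatewise operations on product measures\<close>

text \<open>The coordinate projections are jointly distributed according to the product of their own laws,
  because the joint projection is the identity.\<close>

lemma indep_vars_PiM_coordinates: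
  assumes "\<And>i. i \<in> I \<Longrightarrow> prob_space (M i)"
  shows "prob_space.indep_vars (PiM I M) M (\<lambda>i x. x i) I"
proof (cases "I = {}")
  case False
  interpret prob_space "PiM I M"
    by (rule prob_space_PiM) (rule assms)
  have "distr (PiM I M) (PiM I M) (\<lambda>x. \<lambda>i\<in>I. x i) = distr (PiM I M) (PiM I M) (\<lambda>x. x)"
    by (rule distr_cong) (auto simp: space_PiM PiE_restrict)
  also have "\<dots> = PiM I M"
    by (rule distr_id2) simp
  also have "\<dots> = PiM I (\<lambda>i. distr (PiM I M) (M i) (\<lambda>x. x i))"
    by (rule PiM_cong) (auto simp: distr_PiM_component assms)
  finally show ?thesis
    by (subst indep_vars_iff_distr_eq_PiM'[OF False]) auto
next
  case True
  interpret prob_space "PiM I M"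
    by (rule prob_space_PiM) (rule assms)
  show ?thesis
    unfolding indep_vars_def indep_sets_def using True by auto
qed

lemma indep_vars_PiM_components:
  assumes "\<And>i. i \<in> I \<Longrightarrow> prob_space (M i)" "\<And>i. i \<in> I \<Longrightarrow> g i \<in> M i \<rightarrow>\<^sub>M N i"
  shows "prob_space.indep_vars (PiM I M) N (\<lambda>i x. g i (x i)) I"
proof -
  interpret prob_space "PiM I M"
    by (rule prob_space_PiM) (rule assms)
  show ?thesis
    by (rule indep_vars_compose2[OF indep_vars_PiM_coordinates]) (use assms in auto)
qed

lemma distr_PiM_coordinatewise:
  assumes "I \<noteq> {}" "\<And>i. i \<in> I \<Longrightarrow> prob_space (M i)" "\<And>i. i \<in> I \<Longrightarrow> g i \<in> M i \<rightarrow>\<^sub>M N i"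
  shows "distr (PiM I M) (PiM I N) (\<lambda>x. \<lambda>i\<in>I. g i (x i)) = PiM I (\<lambda>i. distr (M i) (N i) (g i))"
proof -
  interpret prob_space "PiM I M"
    by (rule prob_space_PiM) (rule assms)
  have "distr (PiM I M) (N i) (\<lambda>x. g i (x i)) = distr (M i) (N i) (g i)" if "i \<in> I" for i
  proof -
    have "distr (M i) (N i) (g i) = distr (distr (PiM I M) (M i) (\<lambda>x. x i)) (N i) (g i)"
      by (simp add: distr_PiM_component assms that)
    also have "\<dots> = distr (PiM I M) (N i) (\<lambda>x. g i (x i))"
      using that by (subst distr_distr) (auto simp: comp_def assms)
    finally show ?thesis ..
  qed
  then have "PiM I (\<lambda>i. distr (PiM I M) (N i) (\<lambda>x. g i (x i))) = PiM I (\<lambda>i. distr (M i) (N i) (g i))"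
    by (intro PiM_cong) auto
  moreover have "random_variable (N i) (\<lambda>x. g i (x i))" if "i \<in> I" for i
    using that assms(3) measurable_compose measurable_component_singleton by metis
  ultimately show ?thesis
    using indep_vars_PiM_components[of I M g N] assms
    by (subst (asm) indep_vars_iff_distr_eq_PiM') auto
qed

lemma nn_integral_PiM_prod:
  fixes f :: "'i \<Rightarrow> 'a \<Rightarrow> real"
  assumes "finite K" "K \<subseteq> I" "\<And>i. i \<in> I \<Longrightarrow> prob_space (M i)"
    and "\<And>i. i \<in> K \<Longrightarrow> f i \<in> borel_measurable (M i)" "\<And>i x. i \<in> K \<Longrightarrow> 0 \<le> f i x"
  shows "(\<integral>\<^sup>+x. ennreal (\<Prod>i\<in>K. f i (x i)) \<partial>PiM I M) = (\<Prod>i\<in>K. \<integral>\<^sup>+x. ennreal (f i x) \<partial>M i)"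
proof -
  interpret prob_space "PiM I M"
    by (rule prob_space_PiM) (rule assms)
  have "indep_vars M (\<lambda>i x. x i) K"
    using indep_vars_PiM_coordinates[of I M] assms indep_vars_subset by blast
  then have ind: "indep_vars (\<lambda>_. borel) (\<lambda>i x. f i (x i)) K"
    by (rule indep_vars_compose2) (use assms in auto)
  have "(\<integral>\<^sup>+x. ennreal (\<Prod>i\<in>K. f i (x i)) \<partial>PiM I M) = (\<integral>\<^sup>+x. (\<Prod>i\<in>K. ennreal (f i (x i))) \<partial>PiM I M)"
    by (intro nn_integral_cong) (simp add: prod_ennreal assms)
  also have "\<dots> = (\<Prod>i\<in>K. \<integral>\<^sup>+x. ennreal (f i (x i)) \<partial>PiM I M)"
    by (rule indep_vars_nn_integral[OF assms(1)])
       (use indep_vars_compose2[OF ind, of "\<lambda>_. ennreal" "\<lambda>_. borel"] in auto)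
  also have "\<dots> = (\<Prod>i\<in>K. \<integral>\<^sup>+x. ennreal (f i x) \<partial>M i)"
  proof (rule prod.cong[OF refl])
    fix i assume i: "i \<in> K"
    then have "(\<integral>\<^sup>+x. ennreal (f i x) \<partial>M i) = (\<integral>\<^sup>+x. ennreal (f i x) \<partial>distr (PiM I M) (M i) (\<lambda>x. x i))"
      using assms by (subst distr_PiM_component) auto
    also have "\<dots> = (\<integral>\<^sup>+x. ennreal (f i (x i)) \<partial>PiM I M)"
      using assms(1,2,4) i by (subst nn_integral_distr) auto
    finally show "(\<integral>\<^sup>+x. ennreal (f i (x i)) \<partial>PiM I M) = (\<integral>\<^sup>+x. ennreal (f i x) \<partial>M i)" ..
  qed
  finally show ?thesis .
qed

text \<open>Reweighting finitely many factors of a product by probability densities, the remaining factors being left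
  alone, is the same as reweighting the product. With infinitely many non-trivial densities the two measures may
  be mutually singular (Kakutani), which is why the product of densities runs over a finite set.\<close>

lemma density_PiM_finite:
  fixes f :: "'i \<Rightarrow> 'a \<Rightarrow> real"
  assumes K: "finite K" "K \<subseteq> I" and M: "\<And>i. prob_space (M i)"
    and f: "\<And>i. f i \<in> borel_measurable (M i)" "\<And>i x. 0 \<le> f i x" "\<And>i. (\<integral>\<^sup>+x. ennreal (f i x) \<partial>M i) = 1"
    and f1: "\<And>i x. i \<in> I - K \<Longrightarrow> f i x = 1"
  shows "density (PiM I M) (\<lambda>x. ennreal (\<Prod>i\<in>K. f i (x i))) = PiM I (\<lambda>i. density (M i) (\<lambda>x. ennreal (f i x)))"
proof -
  have prob: "prob_space (density (M i) (\<lambda>x. ennreal (f i x)))" for i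
    using f by (intro prob_spaceI) (simp add: emeasure_density)
  interpret product_prob_space "\<lambda>i. density (M i) (\<lambda>x. ennreal (f i x))" I
    unfolding product_prob_space_def product_prob_space_axioms_def product_sigma_finite_def
    using prob prob_space_imp_sigma_finite by blast
  have [measurable]: "(\<lambda>x. \<Prod>i\<in>K. f i (x i)) \<in> borel_measurable (PiM I M)"
  proof (intro borel_measurable_prod)
    fix i assume "i \<in> K"
    then show "(\<lambda>x. f i (x i)) \<in> borel_measurable (PiM I M)"
      using f(1)[of i] K by (intro measurable_compose[OF measurable_component_singleton]) auto
  qed
  \<comment> \<open>It suffices to compare both measures on cylinders. The cylinder over \<open>L\<close> has to be seen as one over
    \<open>K \<union> L\<close>, with full factors \<open>B i\<close> outside \<open>L\<close>, so that density and indicator become one product.\<close>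
  show ?thesis
  proof (rule PiM_eq)
    show "sets (density (PiM I M) (\<lambda>x. ennreal (\<Prod>i\<in>K. f i (x i)))) = sets (PiM I (\<lambda>i. density (M i) (\<lambda>x. ennreal (f i x))))"
      unfolding sets_density by (rule sets_PiM_cong) auto
    fix L F assume L: "finite L" "L \<subseteq> I" and F: "\<And>i. i \<in> L \<Longrightarrow> F i \<in> sets (density (M i) (\<lambda>x. ennreal (f i x)))"
    define B where "B i = (if i \<in> L then F i else space (M i))" for i
    have B: "B i \<in> sets (M i)" for i using F by (auto simp: B_def)
    let ?E = "prod_emb I (\<lambda>i. density (M i) (\<lambda>x. ennreal (f i x))) L (Pi\<^sub>E L F)"
    have E: "?E = prod_emb I M L (Pi\<^sub>E L F)"
      by (auto simp: prod_emb_def)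
    have Em: "?E \<in> sets (PiM I M)"
      unfolding E using L F by (intro sets_PiM_I) auto
    have "emeasure (density (PiM I M) (\<lambda>x. ennreal (\<Prod>i\<in>K. f i (x i)))) ?E
       = (\<integral>\<^sup>+x. ennreal (\<Prod>i\<in>K. f i (x i)) * indicator ?E x \<partial>PiM I M)"
      using Em by (intro emeasure_density) auto
    also have "\<dots> = (\<integral>\<^sup>+x. ennreal (\<Prod>i\<in>K \<union> L. f i (x i) * indicator (B i) (x i)) \<partial>PiM I M)"
    proof (rule nn_integral_cong)
      fix x assume x: "x \<in> space (PiM I M)"
      have "(\<Prod>i\<in>K. f i (x i)) = (\<Prod>i\<in>K \<union> L. f i (x i))"
        by (rule prod.mono_neutral_left) (use K L f1 in auto)
      moreover have "(\<Prod>i\<in>K \<union> L. indicator (B i) (x i) :: real) = indicator ?E x"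
      proof (cases "x \<in> ?E")
        case True
        have "x i \<in> B i" if "i \<in> K \<union> L" for i
          using True that x K(2) by (auto simp: E B_def prod_emb_iff space_PiM PiE_iff dest!: bspec[of L])
        then show ?thesis using True by simp
      next
        case False
        then obtain i where "i \<in> L" "x i \<notin> B i"
          using x L(2) by (auto simp: E B_def prod_emb_iff space_PiM PiE_iff extensional_def)
        then have "(\<Prod>i\<in>K \<union> L. indicator (B i) (x i) :: real) = 0"
          using K L by (intro prod_zero) (auto intro!: bexI[of _ i])
        then show ?thesis using False by simp
      qed
      ultimately show "ennreal (\<Prod>i\<in>K. f i (x i)) * indicator ?E x = ennreal (\<Prod>i\<in>K \<union> L. f i (x i) * indicator (B i) (x i))"
        by (simp add: prod.distrib) (auto simp: indicator_def)
    qed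
    also have "\<dots> = (\<Prod>i\<in>K \<union> L. \<integral>\<^sup>+x. ennreal (f i x * indicator (B i) x) \<partial>M i)"
      by (rule nn_integral_PiM_prod) (use K L M f B in auto)
    also have "\<dots> = (\<Prod>i\<in>K \<union> L. emeasure (density (M i) (\<lambda>x. ennreal (f i x))) (B i))"
    proof (rule prod.cong[OF refl])
      fix i
      show "(\<integral>\<^sup>+x. ennreal (f i x * indicator (B i) x) \<partial>M i) = emeasure (density (M i) (\<lambda>x. ennreal (f i x))) (B i)"
        using f(1) B by (subst emeasure_density) (auto intro!: nn_integral_cong simp: indicator_def)
    qed
    also have "\<dots> = (\<Prod>i\<in>L. emeasure (density (M i) (\<lambda>x. ennreal (f i x))) (B i))"
    proof (rule prod.mono_neutral_right)
      show "\<forall>i\<in>K \<union> L - L. emeasure (density (M i) (\<lambda>x. ennreal (f i x))) (B i) = 1"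
        using prob_space.emeasure_space_1[OF prob] by (simp add: B_def)
    qed (use K L in auto)
    also have "\<dots> = (\<Prod>i\<in>L. emeasure (density (M i) (\<lambda>x. ennreal (f i x))) (F i))"
      by (rule prod.cong) (auto simp: B_def)
    finally show "emeasure (density (PiM I M) (\<lambda>x. ennreal (\<Prod>i\<in>K. f i (x i)))) ?E
      = (\<Prod>i\<in>L. emeasure (density (M i) (\<lambda>x. ennreal (f i x))) (F i))" .
  qed
qed

section \<open>Gaussian likelihood ratios\<close>

text \<open>The Cameron-Martin formula in one dimension: completing the square in the Gaussian density.\<close>

lemma std_normal_exp_density:
  "density std_normal_distribution (\<lambda>x. ennreal (exp (h * x - h\<^sup>2 / 2)))
     = distr std_normal_distribution borel (\<lambda>x. h + x)"
proof -
  interpret prob_space std_normal_distribution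
    by (rule prob_space_normal_density) simp
  have "distributed std_normal_distribution lborel (\<lambda>x. x) std_normal_density"
    by (auto simp: distributed_def distr_id2)
  from normal_density_affine[OF this, of 1 h]
  have "distr std_normal_distribution borel (\<lambda>x. h + x) = density lborel (normal_density h 1)"
    by (auto simp: distributed_def cong: distr_cong)
  also have "\<dots> = density lborel (\<lambda>x. ennreal (std_normal_density x) * ennreal (exp (h * x - h\<^sup>2 / 2)))"
    by (intro arg_cong[where f="density lborel"] ext)
       (simp add: normal_density_def ennreal_mult[symmetric] exp_add[symmetric] power2_eq_square field_simps)
  also have "\<dots> = density std_normal_distribution (\<lambda>x. ennreal (exp (h * x - h\<^sup>2 / 2)))"
    by (subst density_density_eq) auto
  finally show ?thesis ..
qed

lemma nn_integral_std_normal_exp: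
  "(\<integral>\<^sup>+x. ennreal (exp (h * x - h\<^sup>2 / 2)) \<partial>std_normal_distribution) = 1"
proof -
  interpret prob_space std_normal_distribution
    by (rule prob_space_normal_density) simp
  have "(\<integral>\<^sup>+x. ennreal (exp (h * x - h\<^sup>2 / 2)) \<partial>std_normal_distribution)
    = emeasure (density std_normal_distribution (\<lambda>x. ennreal (exp (h * x - h\<^sup>2 / 2)))) UNIV"
    by (subst emeasure_density) auto
  also have "\<dots> = 1"
    unfolding std_normal_exp_density using emeasure_space_1 by (subst emeasure_distr) auto
  finally show ?thesis .
qed

text \<open>A fair mixture of the likelihood ratios of the shifts by \<open>h\<close> and \<open>-h\<close>.\<close>

lemma cosh_times_exp:
  fixes h x :: real
  shows "cosh (h * x) * exp (- (h\<^sup>2 / 2)) = (exp (h * x - h\<^sup>2 / 2) + exp ((-h) * x - (-h)\<^sup>2 / 2)) / 2"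
proof -
  have "cosh (h * x) * exp (- (h\<^sup>2 / 2)) = (exp (h * x) * exp (- (h\<^sup>2 / 2)) + exp (- (h * x)) * exp (- (h\<^sup>2 / 2))) / 2"
    by (simp add: cosh_field_def distrib_right)
  then show ?thesis
    unfolding exp_add[symmetric] by simp
qed

lemma nn_integral_std_normal_cosh:
  "(\<integral>\<^sup>+x. ennreal (cosh (h * x) * exp (- (h\<^sup>2 / 2))) \<partial>std_normal_distribution) = 1"
proof -
  have half: "ennreal ((a + b) / 2) = ennreal (1/2) * ennreal a + ennreal (1/2) * ennreal b"
    if "0 \<le> a" "0 \<le> b" for a b :: real
  proof -
    have "(a + b) / 2 = 1/2 * a + 1/2 * b" by (simp add: add_divide_distrib)
    moreover have "ennreal (1/2 * a + 1/2 * b) = ennreal (1/2 * a) + ennreal (1/2 * b)"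
      by (rule ennreal_plus) (use that in auto)
    moreover have "ennreal (1/2 * a) = ennreal (1/2) * ennreal a" "ennreal (1/2 * b) = ennreal (1/2) * ennreal b"
      by (rule ennreal_mult; use that in auto)+
    ultimately show ?thesis by (simp only:)
  qed
  have "(\<integral>\<^sup>+x. ennreal (cosh (h * x) * exp (- (h\<^sup>2 / 2))) \<partial>std_normal_distribution)
    = (\<integral>\<^sup>+x. ennreal (1/2) * ennreal (exp (h * x - h\<^sup>2 / 2)) + ennreal (1/2) * ennreal (exp ((-h) * x - (-h)\<^sup>2 / 2)) \<partial>std_normal_distribution)"
    unfolding cosh_times_exp by (intro nn_integral_cong half) auto
  also have "\<dots> = ennreal (1/2) * 1 + ennreal (1/2) * 1"
    apply (subst nn_integral_add, simp, simp)
    apply (subst nn_integral_cmult, simp)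
    apply (subst nn_integral_cmult, simp)
    apply (simp only: nn_integral_std_normal_exp)
    done
  also have "\<dots> = ennreal (1/2 + 1/2)"
    by (simp only: mult_1_right, rule ennreal_plus[symmetric]) auto
  finally show ?thesis by simp
qed

text \<open>The second moment of the symmetric mixture: the squares of the two likelihood ratios contribute
  \<open>exp (h\<^sup>2)\<close> each, and their product is the constant \<open>exp (- h\<^sup>2)\<close>.\<close>

lemma nn_integral_std_normal_cosh_square:
  "(\<integral>\<^sup>+x. ennreal ((cosh (h * x) * exp (- (h\<^sup>2 / 2)))\<^sup>2) \<partial>std_normal_distribution) = ennreal (cosh (h\<^sup>2))"
proof -
  interpret prob_space std_normal_distribution
    by (rule prob_space_normal_density) simp
  have *: "(cosh (h * x) * exp (- (h\<^sup>2 / 2)))\<^sup>2 = exp (h\<^sup>2) / 4 * exp ((2*h) * x - (2*h)\<^sup>2 / 2)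
      + exp (h\<^sup>2) / 4 * exp ((-2*h) * x - (-2*h)\<^sup>2 / 2) + exp (- h\<^sup>2) / 2" for x
  proof -
    have e: "(exp (c * x - c\<^sup>2 / 2))\<^sup>2 = exp (c\<^sup>2) * exp ((2*c) * x - (2*c)\<^sup>2 / 2)" for c
      unfolding power2_eq_square exp_add[symmetric] by (rule arg_cong[where f=exp]) (simp add: field_simps)
    have "exp (h * x - h\<^sup>2 / 2) * exp ((-h) * x - (-h)\<^sup>2 / 2) = exp (- h\<^sup>2)"
      unfolding exp_add[symmetric] by (rule arg_cong[where f=exp]) simp
    then show ?thesis
      using e[of h] e[of "-h"] unfolding cosh_times_exp by (simp add: power_divide power2_sum)
  qed
  have "(\<integral>\<^sup>+x. ennreal ((cosh (h * x) * exp (- (h\<^sup>2 / 2)))\<^sup>2) \<partial>std_normal_distribution)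
    = (\<integral>\<^sup>+x. (ennreal (exp (h\<^sup>2) / 4) * ennreal (exp ((2*h) * x - (2*h)\<^sup>2 / 2)) +
       ennreal (exp (h\<^sup>2) / 4) * ennreal (exp ((-2*h) * x - (-2*h)\<^sup>2 / 2))) + ennreal (exp (-h\<^sup>2) / 2) \<partial>std_normal_distribution)"
    unfolding * by (intro nn_integral_cong)
       (simp add: ennreal_mult[symmetric] ennreal_plus[symmetric] del: ennreal_plus)
  also have "\<dots> = (ennreal (exp (h\<^sup>2) / 4) * 1 + ennreal (exp (h\<^sup>2) / 4) * 1) + ennreal (exp (-h\<^sup>2) / 2)"
    apply (subst nn_integral_add, simp, simp)
    apply (subst nn_integral_add, simp, simp)
    apply (subst nn_integral_cmult, simp)
    apply (subst nn_integral_cmult, simp)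
    apply (simp only: nn_integral_std_normal_exp)
    using emeasure_space_1 by simp
  also have "\<dots> = ennreal (cosh (h\<^sup>2))"
  proof -
    have "cosh (h\<^sup>2) = exp (h\<^sup>2) / 4 + exp (h\<^sup>2) / 4 + exp (- h\<^sup>2) / 2"
      by (simp add: cosh_field_def field_simps)
    then show ?thesis
      by (simp only: mult_1_right) (subst ennreal_plus, simp, simp, subst ennreal_plus, simp_all)
  qed
  finally show ?thesis .
qed

lemma prob_space_noise: "prob_space (noise J)"
  unfolding noise_def by (intro prob_space_PiM prob_space_normal_density) simp

lemma sets_noise [measurable_cong]: "sets (noise J) = sets (sample_space J)"
  unfolding noise_def by (rule sets_PiM_cong) auto

lemma space_noise: "space (noise J) = space (sample_space J)"
  by (rule sets_eq_imp_space_eq[OF sets_noise])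

lemma measurable_noise_coordinate:
  assumes "j \<in> J"
  shows "(\<lambda>\<epsilon>. \<epsilon> j) \<in> borel_measurable (noise J)"
  unfolding measurable_cong_sets[OF sets_noise refl]
  by (rule measurable_component_singleton[OF assms])

text \<open>A shift in finitely many coordinates keeps the law of the noise absolutely continuous, also for infinite \<open>J\<close>,
  with the product of the one-dimensional likelihood ratios as density.\<close>

lemma cameron_martin_noise:
  assumes "J \<noteq> {}" "finite K" "K \<subseteq> J" and h: "\<And>j. j \<notin> K \<Longrightarrow> h j = 0"
  shows "distr (noise J) (sample_space J) (\<lambda>\<epsilon>. \<lambda>j\<in>J. h j + \<epsilon> j)
    = density (noise J) (\<lambda>\<epsilon>. ennreal (\<Prod>j\<in>K. exp (h j * \<epsilon> j - (h j)\<^sup>2 / 2)))"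
proof -
  have P: "prob_space std_normal_distribution"
    by (rule prob_space_normal_density) simp
  show ?thesis unfolding noise_def
    by (subst distr_PiM_coordinatewise[OF assms(1) P], simp,
        subst density_PiM_finite[OF assms(2,3) P])
       (auto simp: h nn_integral_std_normal_exp std_normal_exp_density)
qed

section \<open>Mixtures over random signs\<close>

text \<open>Second-moment bound on the total variation distance: a probability density \<open>L\<close> changes the measure of a
  set by at most half the \<open>L\<^sup>1\<close> norm of \<open>L - 1\<close>, hence by at most half its standard deviation. Applied to a rejection
  region, it limits the gain of power over level.\<close>

lemma measure_density_le_of_second_moment:
  fixes L :: "'a \<Rightarrow> real"
  assumes "prob_space M" and v: "v > 0"
    and [measurable]: "L \<in> borel_measurable M" "A \<in> sets M"
    and L0: "\<And>x. L x \<ge> 0"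
    and L1: "(\<integral>\<^sup>+x. ennreal (L x) \<partial>M) = 1"
    and L2: "(\<integral>\<^sup>+x. ennreal ((L x)\<^sup>2) \<partial>M) \<le> ennreal (1 + 4 * v\<^sup>2)"
  shows "emeasure (density M (\<lambda>x. ennreal (L x))) A \<le> emeasure M A + ennreal v"
proof -
  interpret prob_space M by fact
  have i1: "integrable M L" "integral\<^sup>L M L = 1"
    using L0 L1 by (auto intro!: integrableI_nonneg simp: integral_eq_nn_integral)
  have i2: "integrable M (\<lambda>x. (L x)\<^sup>2)"
    by (rule integrableI_nonneg) (use le_less_trans[OF L2] in auto)
  have "ennreal (integral\<^sup>L M (\<lambda>x. (L x)\<^sup>2)) \<le> ennreal (1 + 4 * v\<^sup>2)"
    using L2 by (subst nn_integral_eq_integral[symmetric, OF i2]) auto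
  then have i2': "integral\<^sup>L M (\<lambda>x. (L x)\<^sup>2) \<le> 1 + 4 * v\<^sup>2"
    by (subst (asm) ennreal_le_iff) auto
  have iA: "integrable M (\<lambda>x. L x * indicator A x)"
    using i1(1) by (rule integrable_real_mult_indicator[rotated]) simp
  \<comment> \<open>Since \<open>indicator A - 1/2\<close> is \<open>\<plusminus>1/2\<close>, \<open>(L - 1) * indicator A\<close> is at most
    \<open>(L - 1) / 2 + \<bar>L - 1\<bar> / 2\<close>, whose first term has integral zero. The inequality of arithmetic and geometric means,
    \<open>\<bar>L - 1\<bar> / 2 \<le> (L - 1)\<^sup>2 / (8 * v) + v / 2\<close>, replaces Cauchy-Schwarz: the weight \<open>v\<close> makes both
    terms integrate to at most \<open>v / 2\<close>.\<close>
  have pt: "L x * indicator A x \<le> indicator A x + (L x - 1) / 2 + ((L x)\<^sup>2 - 2 * L x + 1) / (8 * v) + v / 2" for x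
  proof -
    define q where "q = ((L x)\<^sup>2 - 2 * L x + 1) / (8 * v)"
    have "0 \<le> (\<bar>L x - 1\<bar> - 2 * v)\<^sup>2 / (8 * v)"
      using v by simp
    also have "\<dots> = q + v / 2 - \<bar>L x - 1\<bar> / 2"
      using v by (simp add: q_def field_simps power2_eq_square abs_mult_self_eq)
    finally have d: "\<bar>L x - 1\<bar> / 2 \<le> q + v / 2" by simp
    have "L x - 1 \<le> \<bar>L x - 1\<bar>" "1 - L x \<le> \<bar>L x - 1\<bar>"
      by auto
    with d have "L x \<le> 1 + (L x - 1) / 2 + q + v / 2" "0 \<le> (L x - 1) / 2 + q + v / 2"
      by argo+
    then have "L x * indicator A x \<le> indicator A x + (L x - 1) / 2 + q + v / 2"
      by (cases "x \<in> A") (simp_all only: indicator_simps not_False_eq_True mult_1_right mult_zero_right add_0_left)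
    then show ?thesis by (simp only: q_def)
  qed
  have "(LINT x|M. L x * indicator A x) \<le>
      (LINT x|M. indicator A x + (L x - 1) / 2 + ((L x)\<^sup>2 - 2 * L x + 1) / (8 * v) + v / 2)"
    by (rule integral_mono[OF iA _ pt]) (use i1 i2 in \<open>auto intro!: Bochner_Integration.integrable_add Bochner_Integration.integrable_diff integrable_real_indicator simp: emeasure_eq_measure\<close>)
  also have "\<dots> = prob A + (LINT x|M. (L x)\<^sup>2 - 1) / (8 * v) + v / 2"
    using i1 i2 by (simp add: emeasure_eq_measure prob_space)
  also have "\<dots> \<le> prob A + (4 * v\<^sup>2) / (8 * v) + v / 2"
    using i2 i2' v by (intro add_mono divide_right_mono) (auto simp: prob_space)
  also have "\<dots> = prob A + v"
    using v by (simp add: power2_eq_square)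
  finally have *: "(LINT x|M. L x * indicator A x) \<le> prob A + v" .
  have "emeasure (density M (\<lambda>x. ennreal (L x))) A = (\<integral>\<^sup>+x. ennreal (L x * indicator A x) \<partial>M)"
    by (subst emeasure_density) (auto intro!: nn_integral_cong simp: indicator_def)
  also have "\<dots> = ennreal (LINT x|M. L x * indicator A x)"
    by (rule nn_integral_eq_integral[OF iA]) (auto simp: L0)
  also have "\<dots> \<le> ennreal (prob A + v)"
    using * by (rule ennreal_leI)
  finally show ?thesis
    using v by (simp add: emeasure_eq_measure ennreal_plus)
qed

text \<open>Averaging over independent random signs replaces the likelihood ratio of the shift by a product of terms
  \<open>cosh (h j * \<epsilon> j) * exp (- (h j)\<^sup>2 / 2)\<close>, whose second moment \<open>\<Prod>j. cosh ((h j)\<^sup>2)\<close> exceeds one only by order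
  \<open>\<Sum>j. h j ^ 4\<close> for small shifts, while the likelihood ratio of a fixed shift has second moment \<open>exp (\<Sum>j. (h j)\<^sup>2)\<close>. This gain is the source of the
  fourth powers of \<open>\<sigma>\<close> in the rate. The sets \<open>A\<close> of interest are rejection regions: on average over the signs, hence
  for at least one pattern, the power exceeds the level by at most \<open>v\<close>.\<close>

lemma exists_sign_pattern_small_power:
  assumes J: "J \<noteq> {}" and K: "finite K" "K \<subseteq> J" and v: "v > 0"
    and c: "(\<Prod>j\<in>K. cosh ((h j)\<^sup>2)) \<le> 1 + 4 * v\<^sup>2"
    and A [measurable]: "A \<in> sets (sample_space J)"
  shows "\<exists>s. (\<forall>j\<in>K. s j \<in> {-1, 1 :: real}) \<and>
    emeasure (distr (noise J) (sample_space J) (\<lambda>\<epsilon>. \<lambda>j\<in>J. (if j \<in> K then s j * h j else 0) + \<epsilon> j)) A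
      \<le> emeasure (noise J) A + ennreal v"
proof -
  interpret prob_space "noise J" by (rule prob_space_noise)
  have meas: "(\<lambda>x. cosh (h j * x) * exp (- ((h j)\<^sup>2 / 2))) \<in> borel_measurable borel" for j
    unfolding cosh_def by measurable
  have [measurable]: "(\<lambda>x. x j) \<in> borel_measurable (noise J)" if "j \<in> K" for j
    using K that by (intro measurable_noise_coordinate) auto
  define S where "S = Pi\<^sub>E K (\<lambda>_. {-1, 1 :: real})"
  have finS: "finite S" unfolding S_def using K by (intro finite_PiE) auto
  have cardS: "card S = 2 ^ card K"
    unfolding S_def using K by (simp add: card_PiE numeral_2_eq_2)
  define P where "P s = distr (noise J) (sample_space J) (\<lambda>\<epsilon>. \<lambda>j\<in>J. (if j \<in> K then s j * h j else 0) + \<epsilon> j)" for s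
  define l where "l s x = (\<Prod>j\<in>K. exp (s j * h j * x j - (h j)\<^sup>2 / 2))" for s x :: "nat \<Rightarrow> real"
  define L where "L x = (\<Prod>j\<in>K. cosh (h j * x j) * exp (- ((h j)\<^sup>2 / 2)))" for x :: "nat \<Rightarrow> real"
  have [measurable]: "l s \<in> borel_measurable (noise J)" for s
    unfolding l_def by measurable
  have [measurable]: "L \<in> borel_measurable (noise J)"
    unfolding L_def cosh_def by measurable
  have PS: "P s = density (noise J) (\<lambda>x. ennreal (l s x))" if "s \<in> S" for s
    unfolding P_def l_def
  proof (subst cameron_martin_noise[OF J K], simp, intro arg_cong[where f="density (noise J)"] ext arg_cong[where f=ennreal] prod.cong refl)
    fix x :: "nat \<Rightarrow> real" and j assume "j \<in> K"
    then have "s j = -1 \<or> s j = 1" using that unfolding S_def by (auto dest!: PiE_mem)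
    then show "exp ((if j \<in> K then s j * h j else 0) * x j - (if j \<in> K then s j * h j else 0)\<^sup>2 / 2)
      = exp (s j * h j * x j - (h j)\<^sup>2 / 2)"
      using \<open>j \<in> K\<close> by auto
  qed
  \<comment> \<open>Summing over all sign patterns factorises over the coordinates and turns each pair of exponentials
    into a hyperbolic cosine.\<close>
  have avg: "(\<Sum>s\<in>S. l s x) = 2 ^ card K * L x" for x
  proof -
    have "(\<Sum>s\<in>S. l s x) = (\<Prod>j\<in>K. \<Sum>y\<in>{-1,1}. exp (y * h j * x j - (h j)\<^sup>2 / 2))"
      unfolding S_def l_def using K(1) by (subst prod_sum_PiE) auto
    also have "\<dots> = (\<Prod>j\<in>K. 2 * (cosh (h j * x j) * exp (- ((h j)\<^sup>2 / 2))))"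
      unfolding cosh_times_exp by (intro prod.cong) (auto simp: add.commute)
    also have "\<dots> = 2 ^ card K * L x"
      unfolding L_def by (simp add: prod.distrib)
    finally show ?thesis .
  qed
  have P0: "prob_space std_normal_distribution"
    by (rule prob_space_normal_density) simp
  have L1: "(\<integral>\<^sup>+x. ennreal (L x) \<partial>noise J) = 1"
    unfolding L_def noise_def
    by (subst nn_integral_PiM_prod[OF K P0, where f="\<lambda>j x. cosh (h j * x) * exp (- ((h j)\<^sup>2 / 2))"])
       (auto simp: nn_integral_std_normal_cosh intro: meas)
  have L2: "(\<integral>\<^sup>+x. ennreal ((L x)\<^sup>2) \<partial>noise J) = ennreal (\<Prod>j\<in>K. cosh ((h j)\<^sup>2))"
    unfolding L_def noise_def prod_power_distrib
    by (subst nn_integral_PiM_prod[OF K P0, where f="\<lambda>j x. (cosh (h j * x) * exp (- ((h j)\<^sup>2 / 2)))\<^sup>2"])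
       (auto simp: nn_integral_std_normal_cosh_square prod_ennreal intro: borel_measurable_power meas)
  have "(\<Sum>s\<in>S. emeasure (P s) A) = (\<Sum>s\<in>S. \<integral>\<^sup>+x. ennreal (l s x) * indicator A x \<partial>noise J)"
    by (rule sum.cong) (auto simp: PS emeasure_density)
  also have "\<dots> = (\<integral>\<^sup>+x. (\<Sum>s\<in>S. ennreal (l s x) * indicator A x) \<partial>noise J)"
    by (subst nn_integral_sum) auto
  also have "\<dots> = (\<integral>\<^sup>+x. ennreal (2 ^ card K) * (ennreal (L x) * indicator A x) \<partial>noise J)"
  proof (rule nn_integral_cong)
    fix x
    have "(\<Sum>s\<in>S. ennreal (l s x) * indicator A x) = ennreal (\<Sum>s\<in>S. l s x) * indicator A x"
      unfolding sum_distrib_right[symmetric] by (subst sum_ennreal) (auto simp: l_def prod_nonneg)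
    then show "(\<Sum>s\<in>S. ennreal (l s x) * indicator A x) = ennreal (2 ^ card K) * (ennreal (L x) * indicator A x)"
      unfolding avg by (simp add: ennreal_mult' mult.assoc)
  qed
  also have "\<dots> = ennreal (2 ^ card K) * emeasure (density (noise J) (\<lambda>x. ennreal (L x))) A"
    by (simp add: nn_integral_cmult emeasure_density)
  also have "\<dots> \<le> ennreal (2 ^ card K) * (emeasure (noise J) A + ennreal v)"
  proof (intro mult_left_mono measure_density_le_of_second_moment v)
    show "0 \<le> L x" for x unfolding L_def by (intro prod_nonneg) (auto simp: cosh_real_nonneg)
    show "(\<integral>\<^sup>+x. ennreal ((L x)\<^sup>2) \<partial>noise J) \<le> ennreal (1 + 4 * v\<^sup>2)"
      unfolding L2 using c by (rule ennreal_leI)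
  qed (use L1 prob_space_axioms in auto)
  finally have sum_le: "(\<Sum>s\<in>S. emeasure (P s) A) \<le> ennreal (2 ^ card K) * (emeasure (noise J) A + ennreal v)" .
  \<comment> \<open>The smallest power over all patterns is at most the average power.\<close>
  have "\<exists>s\<in>S. emeasure (P s) A \<le> emeasure (noise J) A + ennreal v"
  proof -
    have "S \<noteq> {}" using cardS by auto
    then obtain s where s: "s \<in> S" "\<And>t. t \<in> S \<Longrightarrow> emeasure (P s) A \<le> emeasure (P t) A"
      using ex_is_arg_min_if_finite[OF finS, of "\<lambda>s. emeasure (P s) A"]
      by (auto simp: is_arg_min_def not_less)
    have "ennreal (2 ^ card K) * emeasure (P s) A = of_nat (card S) * emeasure (P s) A"
      by (simp add: cardS ennreal_of_nat_eq_real_of_nat)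
    also have "\<dots> \<le> (\<Sum>t\<in>S. emeasure (P t) A)"
      using s(2) by (rule sum_bounded_below)
    also note sum_le
    finally show ?thesis
      using s(1) by (subst (asm) ennreal_mult_le_mult_iff) (auto simp: ennreal_eq_0_iff not_le)
  qed
  then show ?thesis
    unfolding P_def S_def by (auto simp: PiE_iff)
qed

text \<open>The derivative of \<open>x - tanh x\<close> is \<open>(tanh x)\<^sup>2\<close>.\<close>

lemma tanh_le_self:
  fixes x :: real
  assumes "0 \<le> x"
  shows "tanh x \<le> x"
proof -
  have "0 - tanh 0 \<le> x - tanh x"
  proof (rule DERIV_nonneg_imp_nondecreasing[OF assms])
    fix y :: real
    show "\<exists>d. ((\<lambda>y. y - tanh y) has_real_derivative d) (at y) \<and> 0 \<le> d"
      by (rule exI[of _ "(tanh y)\<^sup>2"]) (auto intro!: derivative_eq_intros)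
  qed
  then show ?thesis by simp
qed

text \<open>The logarithmic derivative of \<open>cosh\<close> is \<open>tanh\<close>, which stays below the identity on the
  positive half-line; evenness covers the negative one.\<close>

lemma cosh_le_exp_half_square:
  fixes x :: real
  shows "cosh x \<le> exp (x\<^sup>2 / 2)"
proof -
  have *: "cosh y \<le> exp (y\<^sup>2 / 2)" if "0 \<le> y" for y :: real
  proof -
    have "0\<^sup>2 / 2 - ln (cosh 0) \<le> y\<^sup>2 / 2 - ln (cosh y)"
    proof (rule DERIV_nonneg_imp_nondecreasing[OF that])
      fix z :: real assume "0 \<le> z"
      then show "\<exists>d. ((\<lambda>y. y\<^sup>2 / 2 - ln (cosh y)) has_real_derivative d) (at z) \<and> 0 \<le> d"
        using tanh_le_self[of z]
        by (intro exI[of _ "z - tanh z"]) (auto intro!: derivative_eq_intros simp: tanh_def divide_simps)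
    qed
    then have "ln (cosh y) \<le> y\<^sup>2 / 2" by simp
    then show ?thesis by (metis cosh_real_pos exp_le_cancel_iff exp_ln)
  qed
  show ?thesis using *[of "\<bar>x\<bar>"] by simp
qed

section \<open>The observation model and the ellipsoid\<close>

lemma measurable_observation:
  "(\<lambda>\<epsilon>. \<lambda>j\<in>J. \<theta> j + \<sigma> j * \<epsilon> j) \<in> noise J \<rightarrow>\<^sub>M sample_space J"
proof (rule measurable_restrict)
  fix j assume "j \<in> J"
  note [measurable] = measurable_noise_coordinate[OF this]
  show "(\<lambda>\<epsilon>. \<theta> j + \<sigma> j * \<epsilon> j) \<in> noise J \<rightarrow>\<^sub>M borel"
    by measurable
qed

text \<open>Both the level and the power of a test are computed on the probability space of the noise.\<close>

lemma emeasure_obs_law: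
  assumes "\<Phi> \<in> sample_space J \<rightarrow>\<^sub>M count_space {0, 1 :: nat}"
  shows "emeasure (obs_law J \<sigma> \<theta>) {y \<in> space (sample_space J). \<Phi> y = k}
    = emeasure (noise J) {\<epsilon> \<in> space (noise J). \<Phi> (\<lambda>j\<in>J. \<theta> j + \<sigma> j * \<epsilon> j) = k}"
proof -
  have "{y \<in> space (sample_space J). \<Phi> y = k} \<in> sets (sample_space J)"
  proof -
    have "{y \<in> space (sample_space J). \<Phi> y = k} = \<Phi> -` ({k} \<inter> {0, 1}) \<inter> space (sample_space J)"
      using measurable_space[OF assms] by auto
    then show ?thesis
      by (simp only:) (rule measurable_sets[OF assms], auto)
  qed
  then have "emeasure (obs_law J \<sigma> \<theta>) {y \<in> space (sample_space J). \<Phi> y = k}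
      = emeasure (noise J) ((\<lambda>\<epsilon>. \<lambda>j\<in>J. \<theta> j + \<sigma> j * \<epsilon> j) -` {y \<in> space (sample_space J). \<Phi> y = k} \<inter> space (noise J))"
    unfolding obs_law_def by (rule emeasure_distr[OF measurable_observation])
  also have "(\<lambda>\<epsilon>. \<lambda>j\<in>J. \<theta> j + \<sigma> j * \<epsilon> j) -` {y \<in> space (sample_space J). \<Phi> y = k} \<inter> space (noise J)
      = {\<epsilon> \<in> space (noise J). \<Phi> (\<lambda>j\<in>J. \<theta> j + \<sigma> j * \<epsilon> j) = k}"
    using measurable_space[OF measurable_observation[where J=J and \<theta>=\<theta> and \<sigma>=\<sigma>]] by auto
  finally show ?thesis .
qed

lemma index_set_member:
  assumes "index_set J" "D \<in> J"
  shows "J \<noteq> {}" "1 \<le> D" "{1..D} \<subseteq> J" "\<And>j. j \<in> J \<Longrightarrow> 1 \<le> j"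
  using assms by (auto simp: index_set_def)

lemma sum_fourth_powers_pos:
  fixes \<sigma> :: "nat \<Rightarrow> real"
  assumes "1 \<le> D" "\<And>j. j \<in> {1..D} \<Longrightarrow> \<sigma> j > 0"
  shows "0 < (\<Sum>j=1..D. (\<sigma> j) ^ 4)"
  using assms(1) by (intro sum_pos zero_less_power assms(2)) auto

lemma c_const_pos: "\<alpha> + \<beta> < 1 \<Longrightarrow> 0 < c_const \<alpha> \<beta>"
  by (auto simp: c_const_def intro!: ln_gt_zero)

text \<open>Beyond \<open>D\<close> the weights are at least \<open>a D\<close>, so the energy of \<open>\<theta>\<close> missed by the first \<open>D\<close> coordinates is at most
  \<open>R\<^sup>2 / (a D)\<^sup>2\<close>.\<close>

lemma ellipsoid_l2_norm_le:
  assumes J: "index_set J" "D \<in> J" and a: "\<forall>j\<in>J. a j > 0" "mono_on J a"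
    and \<theta>: "\<theta> \<in> ellipsoid J a R"
  shows "(l2_norm J \<theta>)\<^sup>2 \<le> (\<Sum>j=1..D. (\<theta> j)\<^sup>2) + R\<^sup>2 / (a D)\<^sup>2"
proof -
  note D = index_set_member[OF J]
  let ?T = "J - {1..D}"
  have sum: "(\<lambda>j. (\<theta> j)\<^sup>2) summable_on J" "(\<lambda>j. (a j)\<^sup>2 * (\<theta> j)\<^sup>2) summable_on J"
    and R: "(\<Sum>\<^sub>\<infinity>j\<in>J. (a j)\<^sup>2 * (\<theta> j)\<^sup>2) \<le> R\<^sup>2"
    using \<theta> by (auto simp: ellipsoid_def l2_def)
  have sumT: "(\<lambda>j. (\<theta> j)\<^sup>2) summable_on ?T" "(\<lambda>j. (a j)\<^sup>2 * (\<theta> j)\<^sup>2) summable_on ?T"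
    using sum by (auto intro: summable_on_subset_banach)
  have aD: "a D > 0" using a J by auto
  have "(l2_norm J \<theta>)\<^sup>2 = (\<Sum>\<^sub>\<infinity>j\<in>J. (\<theta> j)\<^sup>2)"
    unfolding l2_norm_def by (simp add: infsum_nonneg)
  also have "\<dots> = (\<Sum>\<^sub>\<infinity>j\<in>{1..D} \<union> ?T. (\<theta> j)\<^sup>2)"
    using D(3) by (intro infsum_cong_neutral) auto
  also have "\<dots> = (\<Sum>j=1..D. (\<theta> j)\<^sup>2) + (\<Sum>\<^sub>\<infinity>j\<in>?T. (\<theta> j)\<^sup>2)"
    using sumT by (subst infsum_Un_disjoint) auto
  also have "(\<Sum>\<^sub>\<infinity>j\<in>?T. (\<theta> j)\<^sup>2) \<le> R\<^sup>2 / (a D)\<^sup>2"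
  proof -
    have "(a D)\<^sup>2 * (\<Sum>\<^sub>\<infinity>j\<in>?T. (\<theta> j)\<^sup>2) = (\<Sum>\<^sub>\<infinity>j\<in>?T. (a D)\<^sup>2 * (\<theta> j)\<^sup>2)"
      by (rule infsum_cmult_right'[symmetric])
    also have "\<dots> \<le> (\<Sum>\<^sub>\<infinity>j\<in>?T. (a j)\<^sup>2 * (\<theta> j)\<^sup>2)"
    proof (rule infsum_mono[OF _ sumT(2)])
      show "(\<lambda>j. (a D)\<^sup>2 * (\<theta> j)\<^sup>2) summable_on ?T"
        using sumT(1) by (rule summable_on_cmult_right)
      fix j assume j: "j \<in> ?T"
      then have "D \<le> j" using D(4)[of j] by auto
      then have "a D \<le> a j" using a(2) j J(2) by (auto simp: monotone_on_def)
      then show "(a D)\<^sup>2 * (\<theta> j)\<^sup>2 \<le> (a j)\<^sup>2 * (\<theta> j)\<^sup>2"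
        using aD by (intro mult_right_mono power_mono) auto
    qed
    also have "\<dots> \<le> (\<Sum>\<^sub>\<infinity>j\<in>J. (a j)\<^sup>2 * (\<theta> j)\<^sup>2)"
      by (rule infsum_mono2[OF sumT(2) sum(2)]) auto
    also note R
    finally show ?thesis using aD by (simp add: field_simps)
  qed
  finally show ?thesis by simp
qed

lemma finite_support_ellipsoid:
  assumes K: "finite K" "K \<subseteq> J" and \<theta>: "\<theta> \<in> extensional J" "\<And>j. j \<in> J - K \<Longrightarrow> \<theta> j = 0"
    and R: "(\<Sum>j\<in>K. (a j)\<^sup>2 * (\<theta> j)\<^sup>2) \<le> R\<^sup>2"
  shows "\<theta> \<in> ellipsoid J a R" "(l2_norm J \<theta>)\<^sup>2 = (\<Sum>j\<in>K. (\<theta> j)\<^sup>2)"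
proof -
  have s: "f summable_on J" "infsum f J = sum f K" if "\<And>j. j \<in> J - K \<Longrightarrow> f j = 0" for f :: "nat \<Rightarrow> real"
  proof -
    have "f summable_on J \<longleftrightarrow> f summable_on K" "infsum f J = infsum f K"
      using K that by (intro summable_on_cong_neutral infsum_cong_neutral; auto)+
    then show "f summable_on J" "infsum f J = sum f K" using K by auto
  qed
  show "\<theta> \<in> ellipsoid J a R"
    unfolding ellipsoid_def l2_def
    using \<theta> R s[of "\<lambda>j. (\<theta> j)\<^sup>2"] s[of "\<lambda>j. (a j)\<^sup>2 * (\<theta> j)\<^sup>2"] by auto
  show "(l2_norm J \<theta>)\<^sup>2 = (\<Sum>j\<in>K. (\<theta> j)\<^sup>2)"
    unfolding l2_norm_def using \<theta> s(2)[of "\<lambda>j. (\<theta> j)\<^sup>2"] by (simp add: sum_nonneg)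
qed

section \<open>Lower bound on the separation radius\<close>

text \<open>If the radius is too small, the signs of \<open>exists_sign_pattern_small_power\<close> can be attached to a signal of norm \<open>\<rho>\<close>
  inside the ellipsoid. The second moment is controlled by \<open>cosh x \<le> exp (x\<^sup>2 / 2)\<close>, and \<^const>\<open>c_const\<close> is chosen
  to make it at most \<open>1 + 4 * (1 - \<alpha> - \<beta>)\<^sup>2\<close>. Some alternative at distance \<open>\<rho>\<close> is then detected with
  probability at most \<open>\<alpha> + (1 - \<alpha> - \<beta>) = 1 - \<beta>\<close>.\<close>

lemma minimax_lower_bound:
  assumes J: "index_set J" "D \<in> J" and \<sigma>: "\<forall>j\<in>J. \<sigma> j > 0" and a: "\<forall>j\<in>J. a j > 0" "mono_on J a"
    and \<alpha>: "0 < \<alpha>" and \<beta>: "\<beta> < 1 - \<alpha>" and \<Phi>: "\<Phi> \<in> level_tests J \<sigma> \<alpha>" and \<rho>: "\<rho> > 0"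
    and power: "(INF \<theta>\<in>{\<theta> \<in> ellipsoid J a R. l2_norm J \<theta> \<ge> \<rho>}. reject_prob J \<sigma> \<theta> \<Phi>) > ennreal (1 - \<beta>)"
  shows "min (rho_sq \<alpha> \<beta> \<sigma> D) (R\<^sup>2 / (a D)\<^sup>2) < \<rho>\<^sup>2"
proof (rule ccontr)
  assume "\<not> ?thesis"
  then have \<rho>1: "\<rho>\<^sup>2 \<le> rho_sq \<alpha> \<beta> \<sigma> D" and \<rho>2: "\<rho>\<^sup>2 \<le> R\<^sup>2 / (a D)\<^sup>2" by auto
  note D = index_set_member[OF J]
  define v where "v = 1 - \<alpha> - \<beta>"
  have v: "v > 0" using \<beta> by (simp add: v_def)
  define V where "V = (\<Sum>j=1..D. (\<sigma> j) ^ 4)"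
  have V: "V > 0" unfolding V_def
    by (rule sum_fourth_powers_pos) (use D \<sigma> in auto)
  \<comment> \<open>The signal \<open>\<plusminus> \<sigma> j * h j\<close> has squared norm \<open>\<rho>\<^sup>2\<close>. Energy proportional to \<open>\<sigma> j ^ 4\<close> is the allocation
    that minimises \<open>\<Sum>j. h j ^ 4\<close>, half of which bounds the logarithm of the second moment.\<close>
  define h where "h j = \<rho> * \<sigma> j / sqrt V" for j
  have c2: "(c_const \<alpha> \<beta>)\<^sup>2 = 2 * ln (1 + 4 * v\<^sup>2)"
    unfolding c_const_def v_def by (simp add: diff_diff_eq ln_ge_zero)
  have "(\<Prod>j=1..D. cosh ((h j)\<^sup>2)) \<le> (\<Prod>j=1..D. exp (((h j)\<^sup>2)\<^sup>2 / 2))"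
    by (intro prod_mono conjI cosh_real_nonneg cosh_le_exp_half_square)
  also have "\<dots> = exp (\<Sum>j=1..D. ((h j)\<^sup>2)\<^sup>2 / 2)"
    by (simp add: exp_sum)
  also have "(\<Sum>j=1..D. ((h j)\<^sup>2)\<^sup>2 / 2) = (\<Sum>j=1..D. (\<sigma> j) ^ 4 * ((\<rho>\<^sup>2)\<^sup>2 / (2 * V\<^sup>2)))"
    using V by (intro sum.cong) (auto simp: h_def power_divide power_mult_distrib field_simps)
  also have "\<dots> = (\<rho>\<^sup>2)\<^sup>2 / (2 * V)"
    unfolding sum_distrib_right[symmetric] V_def[symmetric] using V by (simp add: power2_eq_square)
  also have "\<dots> \<le> (c_const \<alpha> \<beta> * sqrt V)\<^sup>2 / (2 * V)"
    using \<rho>1 V unfolding rho_sq_def V_def[symmetric] by (intro divide_right_mono power_mono) auto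
  also have "\<dots> = ln (1 + 4 * v\<^sup>2)"
    using V c2 by (simp add: power_mult_distrib)
  also have "exp (ln (1 + 4 * v\<^sup>2)) = 1 + 4 * v\<^sup>2"
    by (rule exp_ln) (simp add: add_pos_nonneg)
  finally have prod: "(\<Prod>j=1..D. cosh ((h j)\<^sup>2)) \<le> 1 + 4 * v\<^sup>2" by simp
  \<comment> \<open>Dividing by \<open>\<sigma> j\<close> coordinatewise reduces the test to one of pure standard noise against shifted noise,
    with rejection region \<open>A\<close>.\<close>
  define A where "A = {\<epsilon> \<in> space (sample_space J). \<Phi> (\<lambda>j\<in>J. \<sigma> j * \<epsilon> j) = 1}"
  have \<Phi>m: "\<Phi> \<in> sample_space J \<rightarrow>\<^sub>M count_space {0, 1}" and \<Phi>0: "reject_prob J \<sigma> (\<lambda>_. 0) \<Phi> \<le> ennreal \<alpha>"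
    using \<Phi> by (auto simp: level_tests_def)
  have "(\<lambda>\<epsilon>. \<Phi> (\<lambda>j\<in>J. \<sigma> j * \<epsilon> j)) \<in> sample_space J \<rightarrow>\<^sub>M count_space {0, 1}"
    by (rule measurable_compose[OF _ \<Phi>m]) (intro measurable_restrict; measurable)
  from measurable_sets[OF this, of "{1}"] have A: "A \<in> sets (sample_space J)"
    unfolding A_def by (simp add: vimage_def Int_def conj_commute)
  have rej: "reject_prob J \<sigma> (\<lambda>j\<in>J. \<sigma> j * \<eta> j) \<Phi>
     = emeasure (distr (noise J) (sample_space J) (\<lambda>\<epsilon>. \<lambda>j\<in>J. \<eta> j + \<epsilon> j)) A" for \<eta>
  proof -
    have m: "(\<lambda>\<epsilon>. \<lambda>j\<in>J. \<eta> j + \<epsilon> j) \<in> noise J \<rightarrow>\<^sub>M sample_space J"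
      using measurable_observation[where J=J and \<theta>=\<eta> and \<sigma>="\<lambda>_. 1"] by simp
    have "(\<lambda>j\<in>J. (\<lambda>j\<in>J. \<sigma> j * \<eta> j) j + \<sigma> j * \<epsilon> j) = (\<lambda>j\<in>J. \<sigma> j * (\<lambda>j\<in>J. \<eta> j + \<epsilon> j) j)" for \<epsilon>
      by (auto simp: fun_eq_iff algebra_simps)
    then show ?thesis
      unfolding reject_prob_def emeasure_obs_law[OF \<Phi>m] emeasure_distr[OF m A]
      using measurable_space[OF m] unfolding A_def
      by (intro arg_cong[where f="emeasure (noise J)"]) auto
  qed
  have rej0: "reject_prob J \<sigma> (\<lambda>_. 0) \<Phi> = emeasure (noise J) A"
    unfolding reject_prob_def emeasure_obs_law[OF \<Phi>m] A_def by (simp add: space_noise)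
  obtain s where s: "\<And>j. j \<in> {1..D} \<Longrightarrow> s j \<in> {-1, 1 :: real}"
    and s_le: "emeasure (distr (noise J) (sample_space J) (\<lambda>\<epsilon>. \<lambda>j\<in>J. (if j \<in> {1..D} then s j * h j else 0) + \<epsilon> j)) A
      \<le> emeasure (noise J) A + ennreal v"
    using exists_sign_pattern_small_power[OF D(1) finite_atLeastAtMost D(3) v prod A] by blast
  define \<theta> where "\<theta> = (\<lambda>j\<in>J. \<sigma> j * (if j \<in> {1..D} then s j * h j else 0))"
  have \<theta>sq: "(\<theta> j)\<^sup>2 = (\<sigma> j) ^ 4 * (\<rho>\<^sup>2 / V)" if "j \<in> {1..D}" for j
  proof -
    have "(s j)\<^sup>2 = 1" using s[OF that] by auto
    then show ?thesis
      using that D(3) V by (auto simp: \<theta>_def h_def power_mult_distrib power_divide field_simps)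
  qed
  have sum_\<theta>: "(\<Sum>j=1..D. (\<theta> j)\<^sup>2) = \<rho>\<^sup>2"
  proof -
    have "(\<Sum>j=1..D. (\<theta> j)\<^sup>2) = (\<Sum>j=1..D. (\<sigma> j) ^ 4 * (\<rho>\<^sup>2 / V))"
      by (rule sum.cong[OF refl \<theta>sq])
    then show ?thesis
      unfolding sum_distrib_right[symmetric] V_def[symmetric] using V by simp
  qed
  have aD: "a D > 0" using a J by auto
  \<comment> \<open>Monotone weights make the ellipsoid contain the ball of radius \<open>R / a D\<close> in the first \<open>D\<close> coordinates.\<close>
  have "(\<Sum>j=1..D. (a j)\<^sup>2 * (\<theta> j)\<^sup>2) \<le> (\<Sum>j=1..D. (a D)\<^sup>2 * (\<theta> j)\<^sup>2)"
  proof (intro sum_mono mult_right_mono power_mono)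
    fix j assume "j \<in> {1..D}"
    then show "a j \<le> a D" "0 \<le> a j" using a D(3) J(2) by (auto simp: monotone_on_def less_imp_le subset_iff)
  qed auto
  also have "\<dots> = (a D)\<^sup>2 * \<rho>\<^sup>2"
    by (simp only: sum_distrib_left[symmetric] sum_\<theta>)
  also have "\<dots> \<le> R\<^sup>2"
    using \<rho>2 aD by (simp add: field_simps)
  finally have R: "(\<Sum>j=1..D. (a j)\<^sup>2 * (\<theta> j)\<^sup>2) \<le> R\<^sup>2" .
  have \<theta>ext: "\<theta> \<in> extensional J"
    unfolding \<theta>_def by (rule restrict_extensional)
  have \<theta>zero: "\<theta> j = 0" if "j \<in> J - {1..D}" for j
    using that by (auto simp: \<theta>_def)
  note fin = finite_support_ellipsoid[OF finite_atLeastAtMost D(3) \<theta>ext \<theta>zero R]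
  have \<theta>E: "\<theta> \<in> ellipsoid J a R" and "(l2_norm J \<theta>)\<^sup>2 = (\<Sum>j=1..D. (\<theta> j)\<^sup>2)"
    by (rule fin; assumption)+
  then have "l2_norm J \<theta> = \<rho>"
    using \<rho> sum_\<theta> by (simp add: l2_norm_def infsum_nonneg real_sqrt_ge_zero)
  then have "ennreal (1 - \<beta>) < reject_prob J \<sigma> \<theta> \<Phi>"
    using \<theta>E by (intro less_le_trans[OF power INF_lower]) auto
  also have "\<dots> \<le> ennreal \<alpha> + ennreal v"
    unfolding \<theta>_def rej using s_le \<Phi>0 unfolding rej0 by (meson add_right_mono order_trans)
  also have "\<dots> = ennreal (1 - \<beta>)"
    using \<alpha> v by (simp add: ennreal_plus[symmetric] v_def del: ennreal_plus)
  finally show False by simp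
qed

section \<open>Quantiles\<close>

context real_distribution
begin

text \<open>As \<open>p\<close> is positive and the distribution function vanishes at minus infinity, the set defining the quantile is
  bounded below, so that its \<^const>\<open>Inf\<close> is a genuine lower bound.\<close>

lemma quantile_le:
  assumes "0 < p" "p \<le> cdf M x"
  shows "quantile M p \<le> x"
proof -
  obtain b where b: "\<And>t. t \<le> b \<Longrightarrow> cdf M t < p"
    using order_tendstoD(2)[OF cdf_lim_at_bot assms(1)] by (auto simp: eventually_at_bot_linorder)
  have "bdd_below {t. p \<le> cdf M t}"
    by (rule bdd_belowI[of _ b]) (meson b leI mem_Collect_eq nle_le not_le)
  then show ?thesis
    unfolding quantile_def using assms(2) by (intro cInf_lower) auto
qed

lemma cdf_quantile_ge:
  assumes "0 < p" "p < 1"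
  shows "p \<le> cdf M (quantile M p)"
proof -
  have "\<forall>\<^sub>F t in at_top. p < cdf M t"
    using order_tendstoD(1)[OF cdf_lim_at_top_prob assms(2)] .
  then obtain x0 where "p \<le> cdf M x0"
    by (auto simp: eventually_at_top_linorder intro: less_imp_le)
  then have ne: "{t. p \<le> cdf M t} \<noteq> {}" by blast
  have "p \<le> cdf M t" if t: "t > quantile M p" for t
  proof -
    obtain u where "p \<le> cdf M u" "u < t"
      using cInf_lessD[OF ne, of t] t unfolding quantile_def by auto
    then show ?thesis using cdf_nondecreasing[of u t] by simp
  qed
  \<comment> \<open>The infimum is attained because the distribution function is continuous from the right.\<close>
  then have "\<forall>\<^sub>F t in at_right (quantile M p). p \<le> cdf M t"
    by (auto simp: eventually_at_filter)
  moreover have "(cdf M \<longlongrightarrow> cdf M (quantile M p)) (at_right (quantile M p))"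
    using cdf_is_right_cont by (simp add: continuous_within)
  ultimately show ?thesis
    by (intro tendsto_lowerbound) auto
qed

end

section \<open>Concentration of the sum of squares\<close>

text \<open>Mixed moments of independent centred variables vanish.\<close>

lemma (in prob_space) second_moment_sum_indep:
  fixes X :: "'i \<Rightarrow> 'a \<Rightarrow> real"
  assumes K: "finite K" and ind: "indep_vars (\<lambda>_. borel) X K"
    and sq: "\<And>i. i \<in> K \<Longrightarrow> integrable M (\<lambda>x. (X i x)\<^sup>2)"
    and mean: "\<And>i. i \<in> K \<Longrightarrow> expectation (X i) = 0"
  shows "integrable M (\<lambda>x. (\<Sum>i\<in>K. X i x)\<^sup>2)"
    and "expectation (\<lambda>x. (\<Sum>i\<in>K. X i x)\<^sup>2) = (\<Sum>i\<in>K. expectation (\<lambda>x. (X i x)\<^sup>2))"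
proof -
  have rv: "random_variable borel (X i)" if "i \<in> K" for i
    using ind that by (auto simp: indep_vars_def)
  have int: "integrable M (X i)" if "i \<in> K" for i
    using square_integrable_imp_integrable[OF rv sq] that by blast
  have prod: "integrable M (\<lambda>x. X i x * X j x)
      \<and> expectation (\<lambda>x. X i x * X j x) = (if i = j then expectation (\<lambda>x. (X i x)\<^sup>2) else 0)"
    if "i \<in> K" "j \<in> K" for i j
  proof (cases "i = j")
    case True
    then show ?thesis using sq[OF that(1)] by (simp add: power2_eq_square)
  next
    case False
    have "indep_vars (\<lambda>_. borel) X {i, j}"
      by (rule indep_vars_subset[OF ind]) (use that in auto)
    then show ?thesis
      using False indep_vars_lebesgue_integral[of "{i, j}" X] indep_vars_integrable[of "{i, j}" X] int mean that
      by auto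
  qed
  have eq: "(\<Sum>i\<in>K. X i x)\<^sup>2 = (\<Sum>i\<in>K. \<Sum>j\<in>K. X i x * X j x)" for x
    by (simp add: power2_eq_square sum_product)
  show "integrable M (\<lambda>x. (\<Sum>i\<in>K. X i x)\<^sup>2)"
    unfolding eq using prod by (intro Bochner_Integration.integrable_sum) auto
  have "expectation (\<lambda>x. (\<Sum>i\<in>K. X i x)\<^sup>2) = (\<Sum>i\<in>K. \<Sum>j\<in>K. expectation (\<lambda>x. X i x * X j x))"
    unfolding eq using prod
    by (subst Bochner_Integration.integral_sum) (auto intro!: sum.cong Bochner_Integration.integral_sum)
  also have "\<dots> = (\<Sum>i\<in>K. \<Sum>j\<in>K. if i = j then expectation (\<lambda>x. (X i x)\<^sup>2) else 0)"
    using prod by (intro sum.cong) auto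
  also have "\<dots> = (\<Sum>i\<in>K. expectation (\<lambda>x. (X i x)\<^sup>2))"
    using K by simp
  finally show "expectation (\<lambda>x. (\<Sum>i\<in>K. X i x)\<^sup>2) = (\<Sum>i\<in>K. expectation (\<lambda>x. (X i x)\<^sup>2))" .
qed

text \<open>One noise variable contributes \<open>(\<theta> + \<sigma> * x)\<^sup>2 - \<theta>\<^sup>2 - \<sigma>\<^sup>2\<close>, which has this form with \<open>c = \<sigma>\<^sup>2\<close> and \<open>d = 2 * \<theta> * \<sigma>\<close>,
  to the centred sum of squares.\<close>

lemma std_normal_quadratic_moments:
  fixes c d :: real
  defines "g \<equiv> \<lambda>x. c * (x\<^sup>2 - 1) + d * x"
  shows "integrable std_normal_distribution g" "(LINT x|std_normal_distribution. g x) = 0"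
    and "integrable std_normal_distribution (\<lambda>x. (g x)\<^sup>2)"
    and "(LINT x|std_normal_distribution. (g x)\<^sup>2) = 2 * c\<^sup>2 + d\<^sup>2"
proof -
  interpret prob_space std_normal_distribution
    by (rule prob_space_normal_density) simp
  have i: "integrable std_normal_distribution (\<lambda>x. x)" "integrable std_normal_distribution (\<lambda>x. x\<^sup>2)"
    "integrable std_normal_distribution (\<lambda>x. x ^ 3)" "integrable std_normal_distribution (\<lambda>x. x ^ 4)"
    using integrable_std_normal_distribution_moment[of 1] integrable_std_normal_distribution_moment[of 2]
      integrable_std_normal_distribution_moment[of 3] integrable_std_normal_distribution_moment[of 4] by simp_all
  have e: "(LINT x|std_normal_distribution. x) = 0" "(LINT x|std_normal_distribution. x\<^sup>2) = 1"
    "(LINT x|std_normal_distribution. x ^ 3) = 0" "(LINT x|std_normal_distribution. x ^ 4) = 3"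
    using std_normal_distribution_even_moments(1)[of 1] std_normal_distribution_even_moments(1)[of 2]
      integral_std_normal_distribution_moment_odd[of 1] integral_std_normal_distribution_moment_odd[of 3]
    by (simp_all add: fact_numeral)
  have sq: "(g x)\<^sup>2 = c\<^sup>2 * x ^ 4 + 2 * c * d * x ^ 3 + (d\<^sup>2 - 2 * c\<^sup>2) * x\<^sup>2 + c\<^sup>2 - 2 * c * d * x" for x
    unfolding g_def by (simp add: power2_eq_square power3_eq_cube power4_eq_xxxx algebra_simps)
  show "integrable std_normal_distribution g" "(LINT x|std_normal_distribution. g x) = 0"
    unfolding g_def using i e prob_space by auto
  show "integrable std_normal_distribution (\<lambda>x. (g x)\<^sup>2)"
    unfolding sq using i by auto
  show "(LINT x|std_normal_distribution. (g x)\<^sup>2) = 2 * c\<^sup>2 + d\<^sup>2"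
    unfolding sq using i e prob_space by (simp add: algebra_simps)
qed

text \<open>Chebyshev's inequality; the right-hand numerator is the variance of the sum of squares.\<close>

lemma noise_chebyshev:
  assumes K: "finite K" "K \<subseteq> J" and \<tau>: "\<tau> > 0"
  shows "measure (noise J) {\<epsilon> \<in> space (noise J).
      \<tau> \<le> \<bar>(\<Sum>j\<in>K. (\<theta> j + \<sigma> j * \<epsilon> j)\<^sup>2) - (\<Sum>j\<in>K. (\<theta> j)\<^sup>2 + (\<sigma> j)\<^sup>2)\<bar>}
    \<le> (\<Sum>j\<in>K. 2 * (\<sigma> j) ^ 4 + 4 * (\<theta> j)\<^sup>2 * (\<sigma> j)\<^sup>2) / \<tau>\<^sup>2"
proof -
  interpret prob_space "noise J" by (rule prob_space_noise)
  have P: "prob_space std_normal_distribution"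
    by (rule prob_space_normal_density) simp
  \<comment> \<open>Centred contribution of one coordinate to the sum of squares, as a function of its noise variable.\<close>
  define g where "g j x = (\<sigma> j)\<^sup>2 * (x\<^sup>2 - 1) + (2 * \<theta> j * \<sigma> j) * x" for j and x :: real
  have gm [measurable]: "g j \<in> borel_measurable borel" for j
    unfolding g_def by measurable
  define X where "X j \<epsilon> = g j (\<epsilon> j)" for j and \<epsilon> :: "nat \<Rightarrow> real"
  have dist: "distr (noise J) std_normal_distribution (\<lambda>\<epsilon>. \<epsilon> j) = std_normal_distribution" if "j \<in> K" for j
    unfolding noise_def using K that P by (intro distr_PiM_component) auto
  have coord: "(\<lambda>\<epsilon>. \<epsilon> j) \<in> noise J \<rightarrow>\<^sub>M std_normal_distribution" if "j \<in> K" for j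
    unfolding noise_def using K that by (intro measurable_component_singleton) auto
  have transfer: "integrable std_normal_distribution f \<Longrightarrow> integrable (noise J) (\<lambda>\<epsilon>. f (\<epsilon> j))"
      "expectation (\<lambda>\<epsilon>. f (\<epsilon> j)) = (LINT x|std_normal_distribution. f x)"
    if "j \<in> K" "f \<in> borel_measurable borel" for j and f :: "real \<Rightarrow> real"
    using integrable_distr_eq[OF coord[OF that(1)], of f] integral_distr[OF coord[OF that(1)], of f] that(2)
    unfolding dist[OF that(1)] by auto
  note mom = std_normal_quadratic_moments[of "(\<sigma> j)\<^sup>2" "2 * \<theta> j * \<sigma> j" for j, folded g_def]
  have ind: "indep_vars (\<lambda>_. borel) X K"
    unfolding X_def
    by (rule indep_vars_subset[OF _ K(2)])
       (use indep_vars_PiM_components[of J "\<lambda>_. std_normal_distribution" g "\<lambda>_. borel"] P in \<open>simp add: noise_def\<close>)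
  have sq: "integrable (noise J) (\<lambda>\<epsilon>. (X j \<epsilon>)\<^sup>2)" if "j \<in> K" for j
    unfolding X_def by (rule transfer(1)[OF that _ mom(3)]) measurable
  have mean: "expectation (X j) = 0" if "j \<in> K" for j
    unfolding X_def using transfer(2)[OF that gm] mom(2) by simp
  have var: "expectation (\<lambda>\<epsilon>. (X j \<epsilon>)\<^sup>2) = 2 * (\<sigma> j) ^ 4 + 4 * (\<theta> j)\<^sup>2 * (\<sigma> j)\<^sup>2" if "j \<in> K" for j
    unfolding X_def using transfer(2)[OF that, of "\<lambda>x. (g j x)\<^sup>2"] mom(4)[of j]
    by (simp add: power_mult_distrib)
  define Z where "Z \<epsilon> = (\<Sum>j\<in>K. X j \<epsilon>)" for \<epsilon>
  have Zm: "random_variable borel Z"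
    unfolding Z_def using ind by (intro borel_measurable_sum) (auto simp: indep_vars_def)
  have Z2: "integrable (noise J) (\<lambda>\<epsilon>. (Z \<epsilon>)\<^sup>2)"
    and EZ2: "expectation (\<lambda>\<epsilon>. (Z \<epsilon>)\<^sup>2) = (\<Sum>j\<in>K. 2 * (\<sigma> j) ^ 4 + 4 * (\<theta> j)\<^sup>2 * (\<sigma> j)\<^sup>2)"
    using second_moment_sum_indep[OF K(1) ind sq mean] var by (auto simp: Z_def)
  have "expectation Z = 0"
    unfolding Z_def
    by (subst Bochner_Integration.integral_sum)
       (use mean transfer(1)[OF _ gm mom(1)] in \<open>auto simp: X_def[abs_def]\<close>)
  then have "prob {\<epsilon> \<in> space (noise J). \<tau> \<le> \<bar>Z \<epsilon>\<bar>} \<le> expectation (\<lambda>\<epsilon>. (Z \<epsilon>)\<^sup>2) / \<tau>\<^sup>2"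
    using Chebyshev_inequality[OF Zm Z2 \<tau>] by simp
  moreover have "Z \<epsilon> = (\<Sum>j\<in>K. (\<theta> j + \<sigma> j * \<epsilon> j)\<^sup>2) - (\<Sum>j\<in>K. (\<theta> j)\<^sup>2 + (\<sigma> j)\<^sup>2)" for \<epsilon>
    unfolding Z_def X_def g_def sum_subtractf[symmetric]
    by (rule sum.cong) (auto simp: power2_eq_square algebra_simps)
  ultimately show ?thesis unfolding EZ2 by simp
qed

section \<open>Level and power of the chi-square test\<close>

lemma measurable_sum_squares:
  assumes "{1..D} \<subseteq> J"
  shows "(\<lambda>\<epsilon>. \<Sum>j=1..D. (\<theta> j + \<sigma> j * \<epsilon> j)\<^sup>2) \<in> borel_measurable (noise J)"
proof (rule borel_measurable_sum)
  fix j assume "j \<in> {1..D}"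
  with assms have "j \<in> J" by auto
  note [measurable] = measurable_noise_coordinate[OF this]
  show "(\<lambda>\<epsilon>. (\<theta> j + \<sigma> j * \<epsilon> j)\<^sup>2) \<in> borel_measurable (noise J)"
    by measurable
qed

lemma chi_test_measurable:
  assumes "{1..D} \<subseteq> J"
  shows "chi_test J \<sigma> D \<alpha> \<in> sample_space J \<rightarrow>\<^sub>M count_space {0, 1}"
proof -
  have [measurable]: "(\<lambda>y. \<Sum>j=1..D. (y j)\<^sup>2) \<in> borel_measurable (sample_space J)"
    using measurable_sum_squares[OF assms, of "\<lambda>_. 0" "\<lambda>_. 1"]
    unfolding measurable_cong_sets[OF sets_noise refl] by simp
  show ?thesis unfolding chi_test_def[abs_def] by measurable
qed

lemma chi_test_prob:
  assumes "{1..D} \<subseteq> J"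
  shows "accept_prob J \<sigma> \<theta> (chi_test J \<sigma> D \<alpha>)
      = ennreal (measure (noise J) {\<epsilon> \<in> space (noise J).
          (\<Sum>j=1..D. (\<theta> j + \<sigma> j * \<epsilon> j)\<^sup>2) \<le> chi_quantile J \<sigma> D (1 - \<alpha>)})" (is "_ = ennreal ?p")
    and "reject_prob J \<sigma> \<theta> (chi_test J \<sigma> D \<alpha>)
      = ennreal (1 - measure (noise J) {\<epsilon> \<in> space (noise J).
          (\<Sum>j=1..D. (\<theta> j + \<sigma> j * \<epsilon> j)\<^sup>2) \<le> chi_quantile J \<sigma> D (1 - \<alpha>)})"
proof -
  interpret prob_space "noise J" by (rule prob_space_noise)
  note [measurable] = measurable_sum_squares[OF assms]
  have T: "(\<Sum>j=1..D. ((\<lambda>j\<in>J. \<theta> j + \<sigma> j * \<epsilon> j) j)\<^sup>2) = (\<Sum>j=1..D. (\<theta> j + \<sigma> j * \<epsilon> j)\<^sup>2)" for \<epsilon>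
    using assms by (intro sum.cong) auto
  show "accept_prob J \<sigma> \<theta> (chi_test J \<sigma> D \<alpha>) = ennreal ?p"
    unfolding accept_prob_def emeasure_obs_law[OF chi_test_measurable[OF assms]] emeasure_eq_measure
    by (intro arg_cong[where f="\<lambda>A. ennreal (prob A)"]) (auto simp: chi_test_def T[simplified] not_less)
  have ev: "{\<epsilon> \<in> space (noise J). (\<Sum>j=1..D. (\<theta> j + \<sigma> j * \<epsilon> j)\<^sup>2) \<le> chi_quantile J \<sigma> D (1 - \<alpha>)} \<in> events"
    by measurable
  have "reject_prob J \<sigma> \<theta> (chi_test J \<sigma> D \<alpha>) = ennreal (prob (space (noise J) -
      {\<epsilon> \<in> space (noise J). (\<Sum>j=1..D. (\<theta> j + \<sigma> j * \<epsilon> j)\<^sup>2) \<le> chi_quantile J \<sigma> D (1 - \<alpha>)}))"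
    unfolding reject_prob_def emeasure_obs_law[OF chi_test_measurable[OF assms]] emeasure_eq_measure
    by (intro arg_cong[where f="\<lambda>A. ennreal (prob A)"]) (auto simp: chi_test_def T[simplified] not_less)
  then show "reject_prob J \<sigma> \<theta> (chi_test J \<sigma> D \<alpha>) = ennreal (1 - ?p)"
    unfolding prob_compl[OF ev] .
qed

text \<open>The zero signal is kept explicit so that this event is an instance of the events occurring in
  \<open>chi_test_prob\<close> and \<open>noise_chebyshev\<close>.\<close>

lemma cdf_weighted_chi_square:
  assumes "{1..D} \<subseteq> J"
  shows "real_distribution (distr (noise J) borel (\<lambda>\<epsilon>. \<Sum>j=1..D. (\<sigma> j)\<^sup>2 * (\<epsilon> j)\<^sup>2))"
    and "cdf (distr (noise J) borel (\<lambda>\<epsilon>. \<Sum>j=1..D. (\<sigma> j)\<^sup>2 * (\<epsilon> j)\<^sup>2)) t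
      = measure (noise J) {\<epsilon> \<in> space (noise J). (\<Sum>j=1..D. (0 + \<sigma> j * \<epsilon> j)\<^sup>2) \<le> t}"
proof -
  interpret prob_space "noise J" by (rule prob_space_noise)
  have m: "(\<lambda>\<epsilon>. \<Sum>j=1..D. (\<sigma> j)\<^sup>2 * (\<epsilon> j)\<^sup>2) \<in> borel_measurable (noise J)"
    using measurable_sum_squares[OF assms, of "\<lambda>_. 0" \<sigma>] by (simp only: power_mult_distrib add_0_left)
  show "real_distribution (distr (noise J) borel (\<lambda>\<epsilon>. \<Sum>j=1..D. (\<sigma> j)\<^sup>2 * (\<epsilon> j)\<^sup>2))"
    by (rule real_distribution_distr[OF m])
  show "cdf (distr (noise J) borel (\<lambda>\<epsilon>. \<Sum>j=1..D. (\<sigma> j)\<^sup>2 * (\<epsilon> j)\<^sup>2)) t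
      = prob {\<epsilon> \<in> space (noise J). (\<Sum>j=1..D. (0 + \<sigma> j * \<epsilon> j)\<^sup>2) \<le> t}"
    unfolding cdf_def by (subst measure_distr[OF m]) (auto intro!: arg_cong[where f=prob] simp: power_mult_distrib)
qed

lemma chi_test_in_level_tests:
  assumes "{1..D} \<subseteq> J" "0 < \<alpha>" "\<alpha> < 1"
  shows "chi_test J \<sigma> D \<alpha> \<in> level_tests J \<sigma> \<alpha>"
proof -
  have "1 - \<alpha> \<le> measure (noise J) {\<epsilon> \<in> space (noise J).
      (\<Sum>j=1..D. (0 + \<sigma> j * \<epsilon> j)\<^sup>2) \<le> chi_quantile J \<sigma> D (1 - \<alpha>)}"
    using real_distribution.cdf_quantile_ge[OF cdf_weighted_chi_square(1)[OF assms(1)], of "1 - \<alpha>" \<sigma>] assms(2,3)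
    unfolding chi_quantile_def cdf_weighted_chi_square(2)[OF assms(1)] by auto
  then have "reject_prob J \<sigma> (\<lambda>_. 0) (chi_test J \<sigma> D \<alpha>) \<le> ennreal \<alpha>"
    unfolding chi_test_prob(2)[OF assms(1)] by (intro ennreal_leI) linarith
  then show ?thesis
    using chi_test_measurable[OF assms(1)] by (simp add: level_tests_def)
qed

text \<open>Under the null hypothesis the statistic has mean \<open>\<Sum>j. (\<sigma> j)\<^sup>2\<close> and variance \<open>2 * (\<Sum>j. \<sigma> j ^ 4)\<close>. Chebyshev's
  inequality puts probability at most \<open>\<alpha>\<close> on exceeding the mean by \<open>sqrt (2 / \<alpha>)\<close> times the root of the fourth-power sum.\<close>

lemma chi_quantile_le:
  assumes "{1..D} \<subseteq> J" "0 < \<alpha>" "\<alpha> < 1" and V: "0 < (\<Sum>j=1..D. (\<sigma> j) ^ 4)"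
  shows "chi_quantile J \<sigma> D (1 - \<alpha>) \<le> (\<Sum>j=1..D. (\<sigma> j)\<^sup>2) + sqrt (2 / \<alpha>) * sqrt (\<Sum>j=1..D. (\<sigma> j) ^ 4)"
  unfolding chi_quantile_def
proof (rule real_distribution.quantile_le[OF cdf_weighted_chi_square(1)[OF assms(1)]])
  interpret prob_space "noise J" by (rule prob_space_noise)
  note [measurable] = measurable_sum_squares[OF assms(1)]
  define m where "m = (\<Sum>j=1..D. (\<sigma> j)\<^sup>2)"
  define \<tau> where "\<tau> = sqrt (2 / \<alpha>) * sqrt (\<Sum>j=1..D. (\<sigma> j) ^ 4)"
  have \<tau>: "\<tau> > 0" unfolding \<tau>_def using assms by simp
  let ?T = "\<lambda>\<epsilon>. \<Sum>j=1..D. (0 + \<sigma> j * \<epsilon> j)\<^sup>2"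
  have "prob {\<epsilon> \<in> space (noise J). \<tau> \<le> \<bar>?T \<epsilon> - m\<bar>} \<le> (\<Sum>j=1..D. 2 * (\<sigma> j) ^ 4) / \<tau>\<^sup>2"
    using noise_chebyshev[OF _ assms(1) \<tau>, of "\<lambda>_. 0" \<sigma>] by (simp add: m_def)
  also have "\<dots> = \<alpha>"
    using V assms(2) by (simp add: \<tau>_def power_mult_distrib sum_distrib_left[symmetric] less_imp_le)
  finally have "1 - \<alpha> \<le> 1 - prob {\<epsilon> \<in> space (noise J). \<tau> \<le> \<bar>?T \<epsilon> - m\<bar>}" by simp
  also have "\<dots> = prob (space (noise J) - {\<epsilon> \<in> space (noise J). \<tau> \<le> \<bar>?T \<epsilon> - m\<bar>})"
    by (rule prob_compl[symmetric]) measurable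
  also have "\<dots> \<le> prob {\<epsilon> \<in> space (noise J). ?T \<epsilon> \<le> m + \<tau>}"
  proof (rule finite_measure_mono)
    show "space (noise J) - {\<epsilon> \<in> space (noise J). \<tau> \<le> \<bar>?T \<epsilon> - m\<bar>} \<subseteq> {\<epsilon> \<in> space (noise J). ?T \<epsilon> \<le> m + \<tau>}"
      by auto
  qed measurable
  finally show "1 - \<alpha> \<le> cdf (distr (noise J) borel (\<lambda>\<epsilon>. \<Sum>j=1..D. (\<sigma> j)\<^sup>2 * (\<epsilon> j)\<^sup>2)) (m + \<tau>)"
    unfolding cdf_weighted_chi_square(2)[OF assms(1)] .
qed (use assms in auto)

text \<open>Let \<open>s\<close> be the square root of \<open>\<Sum>j. \<sigma> j ^ 4\<close> and \<open>S\<close> the energy of the signal in the first \<open>D\<close> coordinates. The term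
  \<open>2 * sqrt (2 / \<alpha>)\<close> guarantees that the threshold lies at least \<open>S / 2\<close> below the mean of the statistic.
  The variance is at most \<open>6 * s * S\<close>, so acceptance has probability at most \<open>24 * s / S\<close>, and the term
  \<open>48 / \<beta>\<close> brings this down to \<open>\<beta> / 2\<close>.\<close>

lemma chi_test_accept_le:
  assumes D: "{1..D} \<subseteq> J" and \<alpha>: "0 < \<alpha>" "\<alpha> < 1" and \<beta>: "0 < \<beta>" "\<beta> < 1"
    and V: "0 < (\<Sum>j=1..D. (\<sigma> j) ^ 4)"
    and S: "(48 / \<beta> + 2 * sqrt (2 / \<alpha>)) * sqrt (\<Sum>j=1..D. (\<sigma> j) ^ 4) \<le> (\<Sum>j=1..D. (\<theta> j)\<^sup>2)"
  shows "measure (noise J) {\<epsilon> \<in> space (noise J).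
          (\<Sum>j=1..D. (\<theta> j + \<sigma> j * \<epsilon> j)\<^sup>2) \<le> chi_quantile J \<sigma> D (1 - \<alpha>)} \<le> \<beta> / 2"
proof -
  interpret prob_space "noise J" by (rule prob_space_noise)
  note [measurable] = measurable_sum_squares[OF D]
  define s where "s = sqrt (\<Sum>j=1..D. (\<sigma> j) ^ 4)"
  define S where "S = (\<Sum>j=1..D. (\<theta> j)\<^sup>2)"
  define q where "q = sqrt (2 / \<alpha>)"
  have s: "s > 0" and s2: "s\<^sup>2 = (\<Sum>j=1..D. (\<sigma> j) ^ 4)" using V by (auto simp: s_def)
  have q: "q > 0" using \<alpha> by (simp add: q_def)
  have S1: "48 / \<beta> * s + 2 * q * s \<le> S"
    using S by (simp only: s_def[symmetric] S_def[symmetric] q_def[symmetric] distrib_right)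
  moreover have "48 * s \<le> 48 / \<beta> * s" "0 < q * s"
    using \<beta> s q by (auto simp: field_simps)
  ultimately have Ss: "s \<le> S" "S / 2 \<le> S - q * s" "48 / \<beta> * s \<le> S" "0 < S"
    using s by linarith+
  \<comment> \<open>No single \<open>(\<sigma> j)\<^sup>2\<close> exceeds \<open>s\<close>, so the cross terms of the variance cost at most \<open>4 * s * S\<close>.\<close>
  have var: "(\<Sum>j=1..D. 2 * (\<sigma> j) ^ 4 + 4 * (\<theta> j)\<^sup>2 * (\<sigma> j)\<^sup>2) \<le> 6 * s * S"
  proof -
    have "(\<theta> j)\<^sup>2 * (\<sigma> j)\<^sup>2 \<le> (\<theta> j)\<^sup>2 * s" if "j \<in> {1..D}" for j
    proof (rule mult_left_mono)
      have "((\<sigma> j)\<^sup>2)\<^sup>2 \<le> (\<Sum>j=1..D. (\<sigma> j) ^ 4)"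
        using member_le_sum[OF that, of "\<lambda>j. (\<sigma> j) ^ 4"] by simp
      then show "(\<sigma> j)\<^sup>2 \<le> s" unfolding s_def by (rule real_le_rsqrt)
    qed simp
    then have "(\<Sum>j=1..D. (\<theta> j)\<^sup>2 * (\<sigma> j)\<^sup>2) \<le> S * s"
      unfolding S_def sum_distrib_right by (rule sum_mono)
    moreover have "s\<^sup>2 \<le> s * S" using Ss(1) s by (simp add: power2_eq_square)
    moreover have "(\<Sum>j=1..D. 2 * (\<sigma> j) ^ 4 + 4 * (\<theta> j)\<^sup>2 * (\<sigma> j)\<^sup>2)
        = 2 * s\<^sup>2 + 4 * (\<Sum>j=1..D. (\<theta> j)\<^sup>2 * (\<sigma> j)\<^sup>2)"
      by (simp add: s2 sum.distrib sum_distrib_left mult.assoc)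
    ultimately show ?thesis by (simp add: mult.commute)
  qed
  have "prob {\<epsilon> \<in> space (noise J). (\<Sum>j=1..D. (\<theta> j + \<sigma> j * \<epsilon> j)\<^sup>2) \<le> chi_quantile J \<sigma> D (1 - \<alpha>)}
    \<le> prob {\<epsilon> \<in> space (noise J). S / 2 \<le> \<bar>(\<Sum>j=1..D. (\<theta> j + \<sigma> j * \<epsilon> j)\<^sup>2) - (\<Sum>j=1..D. (\<theta> j)\<^sup>2 + (\<sigma> j)\<^sup>2)\<bar>}"
  proof (rule finite_measure_mono)
    have "chi_quantile J \<sigma> D (1 - \<alpha>) - (\<Sum>j=1..D. (\<theta> j)\<^sup>2 + (\<sigma> j)\<^sup>2) \<le> - (S / 2)"
      using chi_quantile_le[OF D \<alpha> V] Ss(2)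
      unfolding sum.distrib s_def[symmetric] q_def[symmetric] S_def[symmetric] by linarith
    then show "{\<epsilon> \<in> space (noise J). (\<Sum>j=1..D. (\<theta> j + \<sigma> j * \<epsilon> j)\<^sup>2) \<le> chi_quantile J \<sigma> D (1 - \<alpha>)}
      \<subseteq> {\<epsilon> \<in> space (noise J). S / 2 \<le> \<bar>(\<Sum>j=1..D. (\<theta> j + \<sigma> j * \<epsilon> j)\<^sup>2) - (\<Sum>j=1..D. (\<theta> j)\<^sup>2 + (\<sigma> j)\<^sup>2)\<bar>}"
    proof (intro Collect_mono impI conjI; elim conjE)
      fix \<epsilon>
      let ?T = "\<Sum>j=1..D. (\<theta> j + \<sigma> j * \<epsilon> j)\<^sup>2" and ?m = "\<Sum>j=1..D. (\<theta> j)\<^sup>2 + (\<sigma> j)\<^sup>2"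
      assume "chi_quantile J \<sigma> D (1 - \<alpha>) - ?m \<le> - (S / 2)" "?T \<le> chi_quantile J \<sigma> D (1 - \<alpha>)"
      then have "?T - ?m \<le> - (S / 2)" by linarith
      then show "S / 2 \<le> \<bar>?T - ?m\<bar>" by linarith
    qed
  qed measurable
  also have "\<dots> \<le> (\<Sum>j=1..D. 2 * (\<sigma> j) ^ 4 + 4 * (\<theta> j)\<^sup>2 * (\<sigma> j)\<^sup>2) / (S / 2)\<^sup>2"
    by (rule noise_chebyshev[OF _ D]) (use Ss(4) in auto)
  also have "\<dots> \<le> 6 * s * S / (S / 2)\<^sup>2"
    using var by (rule divide_right_mono) simp
  also have "\<dots> = 24 * s / S"
    using Ss(4) by (simp add: power2_eq_square field_simps)
  also have "\<dots> \<le> \<beta> / 2"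
    using Ss(3,4) \<beta> by (simp add: field_simps)
  finally show ?thesis .
qed

section \<open>The minimax rate over an ellipsoid\<close>

theorem proposition3:
  fixes \<alpha> \<beta> :: real
  assumes "0 < \<alpha>" and "\<alpha> < 1" and "0 < \<beta>" and "\<beta> < 1 - \<alpha>"
  shows "\<exists>C>0. \<forall>(J :: nat set) (\<sigma> :: nat \<Rightarrow> real) (a :: nat \<Rightarrow> real) (R :: real).
    index_set J \<and> (\<forall>j\<in>J. \<sigma> j > 0) \<and> (\<forall>j\<in>J. a j > 0) \<and> mono_on J a \<and> R > 0 \<longrightarrow>
      (minimax_rate J \<sigma> (ellipsoid J a R) \<alpha> \<beta>)\<^sup>2
        \<ge> (SUP D\<in>J. ennreal (min (rho_sq \<alpha> \<beta> \<sigma> D) (R\<^sup>2 / (a D)\<^sup>2))) \<and>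
      (\<forall>D\<in>J. (SUP \<theta>\<in>{\<theta> \<in> ellipsoid J a R. (l2_norm J \<theta>)\<^sup>2 \<ge> C * rho_sq \<alpha> \<beta> \<sigma> D + R\<^sup>2 / (a D)\<^sup>2}.
          accept_prob J \<sigma> \<theta> (chi_test J \<sigma> D \<alpha>)) \<le> ennreal \<beta>) \<and>
      (minimax_rate J \<sigma> (ellipsoid J a R) \<alpha> \<beta>)\<^sup>2
        \<le> (INF D\<in>J. ennreal (C * rho_sq \<alpha> \<beta> \<sigma> D + R\<^sup>2 / (a D)\<^sup>2))"
proof -
  \<comment> \<open>\<open>B\<close> is the signal-to-noise ratio required by the power bound of the test; dividing by \<^const>\<open>c_const\<close>
    re-expresses it in units of \<^const>\<open>rho_sq\<close>.\<close>
  define B where "B = 48 / \<beta> + 2 * sqrt (2 / \<alpha>)"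
  define C where "C = B / c_const \<alpha> \<beta>"
  have B: "B > 0" using assms by (simp add: B_def add_pos_pos)
  have c: "c_const \<alpha> \<beta> > 0" by (rule c_const_pos) (use assms in auto)
  have C: "C > 0" using B c by (simp add: C_def)
  have "(SUP D\<in>J. ennreal (min (rho_sq \<alpha> \<beta> \<sigma> D) (R\<^sup>2 / (a D)\<^sup>2))) \<le> (minimax_rate J \<sigma> (ellipsoid J a R) \<alpha> \<beta>)\<^sup>2 \<and>
      (\<forall>D\<in>J. (SUP \<theta>\<in>{\<theta> \<in> ellipsoid J a R. (l2_norm J \<theta>)\<^sup>2 \<ge> C * rho_sq \<alpha> \<beta> \<sigma> D + R\<^sup>2 / (a D)\<^sup>2}.
          accept_prob J \<sigma> \<theta> (chi_test J \<sigma> D \<alpha>)) \<le> ennreal \<beta>) \<and>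
      (minimax_rate J \<sigma> (ellipsoid J a R) \<alpha> \<beta>)\<^sup>2
        \<le> (INF D\<in>J. ennreal (C * rho_sq \<alpha> \<beta> \<sigma> D + R\<^sup>2 / (a D)\<^sup>2))"
    if J: "index_set J" and \<sigma>: "\<forall>j\<in>J. \<sigma> j > 0" and a: "\<forall>j\<in>J. a j > 0" "mono_on J a" and R: "R > 0"
    for J :: "nat set" and \<sigma> a :: "nat \<Rightarrow> real" and R :: real
  proof (intro conjI ballI)
    let ?r = "\<lambda>D. C * rho_sq \<alpha> \<beta> \<sigma> D + R\<^sup>2 / (a D)\<^sup>2"
    have pos: "0 < (\<Sum>j=1..D. (\<sigma> j) ^ 4)" "0 < rho_sq \<alpha> \<beta> \<sigma> D" if D: "D \<in> J" for D
    proof -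
      show V: "0 < (\<Sum>j=1..D. (\<sigma> j) ^ 4)"
        by (rule sum_fourth_powers_pos) (use index_set_member[OF J D] \<sigma> in auto)
      show "0 < rho_sq \<alpha> \<beta> \<sigma> D"
        unfolding rho_sq_def using c V by simp
    qed
    have accept: "measure (noise J) {\<epsilon> \<in> space (noise J).
        (\<Sum>j=1..D. (\<theta> j + \<sigma> j * \<epsilon> j)\<^sup>2) \<le> chi_quantile J \<sigma> D (1 - \<alpha>)} \<le> \<beta> / 2"
      if D: "D \<in> J" and \<theta>: "\<theta> \<in> ellipsoid J a R" "?r D \<le> (l2_norm J \<theta>)\<^sup>2" for D \<theta>
    proof (rule chi_test_accept_le[OF index_set_member(3)[OF J D] _ _ _ _ pos(1)[OF D]])
      have "C * rho_sq \<alpha> \<beta> \<sigma> D \<le> (\<Sum>j=1..D. (\<theta> j)\<^sup>2)"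
        using ellipsoid_l2_norm_le[OF J D a \<theta>(1)] \<theta>(2) by linarith
      then show "(48 / \<beta> + 2 * sqrt (2 / \<alpha>)) * sqrt (\<Sum>j=1..D. (\<sigma> j) ^ 4) \<le> (\<Sum>j=1..D. (\<theta> j)\<^sup>2)"
        unfolding B_def[symmetric] using c by (simp add: C_def rho_sq_def)
    qed (use assms in auto)
    show "(SUP D\<in>J. ennreal (min (rho_sq \<alpha> \<beta> \<sigma> D) (R\<^sup>2 / (a D)\<^sup>2))) \<le> (minimax_rate J \<sigma> (ellipsoid J a R) \<alpha> \<beta>)\<^sup>2"
    proof (rule SUP_least)
      fix D assume D: "D \<in> J"
      let ?m = "min (rho_sq \<alpha> \<beta> \<sigma> D) (R\<^sup>2 / (a D)\<^sup>2)"
      have m: "0 \<le> ?m" using pos(2)[OF D] by simp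
      have "ennreal (sqrt ?m) \<le> minimax_rate J \<sigma> (ellipsoid J a R) \<alpha> \<beta>"
        unfolding minimax_rate_def test_rate_def
      proof (intro INF_greatest ennreal_leI)
        fix \<Phi> \<rho>
        assume \<Phi>: "\<Phi> \<in> level_tests J \<sigma> \<alpha>"
          and "\<rho> \<in> {\<rho>. 0 < \<rho> \<and> ennreal (1 - \<beta>) < (INF \<theta>\<in>{\<theta> \<in> ellipsoid J a R. \<rho> \<le> l2_norm J \<theta>}. reject_prob J \<sigma> \<theta> \<Phi>)}"
        then have \<rho>: "\<rho> > 0" and "ennreal (1 - \<beta>) < (INF \<theta>\<in>{\<theta> \<in> ellipsoid J a R. \<rho> \<le> l2_norm J \<theta>}. reject_prob J \<sigma> \<theta> \<Phi>)"
          by auto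
        then have "?m < \<rho>\<^sup>2"
          by (intro minimax_lower_bound[OF J D \<sigma> a assms(1,4) \<Phi>])
        then show "sqrt ?m \<le> \<rho>"
          using \<rho> by (intro real_le_lsqrt) auto
      qed
      then have "(ennreal (sqrt ?m))\<^sup>2 \<le> (minimax_rate J \<sigma> (ellipsoid J a R) \<alpha> \<beta>)\<^sup>2"
        by (rule power_mono) simp
      then show "ennreal ?m \<le> (minimax_rate J \<sigma> (ellipsoid J a R) \<alpha> \<beta>)\<^sup>2"
        using m by (simp add: ennreal_power)
    qed
    show "(SUP \<theta>\<in>{\<theta> \<in> ellipsoid J a R. ?r D \<le> (l2_norm J \<theta>)\<^sup>2}. accept_prob J \<sigma> \<theta> (chi_test J \<sigma> D \<alpha>)) \<le> ennreal \<beta>"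
      if D: "D \<in> J" for D
    proof (rule SUP_least)
      fix \<theta> assume "\<theta> \<in> {\<theta> \<in> ellipsoid J a R. ?r D \<le> (l2_norm J \<theta>)\<^sup>2}"
      then show "accept_prob J \<sigma> \<theta> (chi_test J \<sigma> D \<alpha>) \<le> ennreal \<beta>"
        unfolding chi_test_prob(1)[OF index_set_member(3)[OF J D]]
        using accept[OF D, of \<theta>] assms(3) by (intro ennreal_leI) auto
    qed
    show "(minimax_rate J \<sigma> (ellipsoid J a R) \<alpha> \<beta>)\<^sup>2 \<le> (INF D\<in>J. ennreal (?r D))"
    proof (rule INF_greatest)
      fix D assume D: "D \<in> J"
      define \<rho> where "\<rho> = sqrt (?r D)"
      have r: "?r D > 0" using C pos(2)[OF D] by (simp add: add_pos_nonneg)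
      have \<rho>: "\<rho> > 0" "\<rho>\<^sup>2 = ?r D" using r by (auto simp: \<rho>_def)
      \<comment> \<open>The error bound \<open>\<beta> / 2\<close> leaves the gap needed for an infimum of powers strictly above \<open>1 - \<beta>\<close>.\<close>
      have "ennreal (1 - \<beta>) < ennreal (1 - \<beta> / 2)"
        using assms by (simp add: ennreal_less_iff)
      also have "\<dots> \<le> (INF \<theta>\<in>{\<theta> \<in> ellipsoid J a R. \<rho> \<le> l2_norm J \<theta>}. reject_prob J \<sigma> \<theta> (chi_test J \<sigma> D \<alpha>))"
      proof (rule INF_greatest)
        fix \<theta> assume \<theta>: "\<theta> \<in> {\<theta> \<in> ellipsoid J a R. \<rho> \<le> l2_norm J \<theta>}"
        then have "\<rho>\<^sup>2 \<le> (l2_norm J \<theta>)\<^sup>2" using \<rho>(1) by (intro power_mono) auto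
        then show "ennreal (1 - \<beta> / 2) \<le> reject_prob J \<sigma> \<theta> (chi_test J \<sigma> D \<alpha>)"
          unfolding chi_test_prob(2)[OF index_set_member(3)[OF J D]]
          using accept[OF D, of \<theta>] \<theta> \<rho>(2) by (intro ennreal_leI) auto
      qed
      finally have "test_rate J \<sigma> (chi_test J \<sigma> D \<alpha>) (ellipsoid J a R) \<beta> \<le> ennreal \<rho>"
        unfolding test_rate_def using \<rho>(1) by (intro INF_lower) auto
      then have "minimax_rate J \<sigma> (ellipsoid J a R) \<alpha> \<beta> \<le> ennreal \<rho>"
        unfolding minimax_rate_def
        by (rule INF_lower2[OF chi_test_in_level_tests[OF index_set_member(3)[OF J D] assms(1,2)]])
      then have "(minimax_rate J \<sigma> (ellipsoid J a R) \<alpha> \<beta>)\<^sup>2 \<le> (ennreal \<rho>)\<^sup>2"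
        by (rule power_mono) simp
      then show "(minimax_rate J \<sigma> (ellipsoid J a R) \<alpha> \<beta>)\<^sup>2 \<le> ennreal (?r D)"
        using \<rho> by (simp add: ennreal_power)
    qed
  qed
  then show ?thesis using C by blast
qed

end
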